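(* Let $1<l<\infty$, $0\le\lambda<\infty$, $0<p_1\le p_2\le\infty$, $\vec q_1=(q_{11},\dots,q_{1n})$ with $1<q_{1i}<l$ for all $i$, $\vec q_2=(q_{21},\dots,q_{2n})\in[1,\infty)^n$, $$\frac1l=\frac1n\sum_{i=1}^n\frac1{q_{1i}}-\frac1n\sum_{i=1}^n\frac1{q_{2i}},\qquad \lambda-\sum_{i=1}^n\frac1{q_{2i}}<\alpha<n-\sum_{i=1}^n\frac1{q_{1i}}.$$ Let $b\in BMO(\mathbb R^n)$ and suppose that the fractional maximal commutator $M_b^l$ is bounded from $L^{\vec q_1}(\mathbb R^n)$ to $L^{\vec q_2}(\mathbb R^n)$. Then $M_b^l$ is bounded from $M\dot K^{\alpha,\lambda}_{p_1,\vec q_1}(\mathbb R^n)$ to $M\dot K^{\alpha,\lambda}_{p_2,\vec q_2}(\mathbb R^n)$, i.e. there is a constant $C$ with $\|M_b^lf\|_{M\dot K^{\alpha,\lambda}_{p_2,\vec q_2}}\le C\|f\|_{M\dot K^{\alpha,\lambda}_{p_1,\vec q_1}}$ for all $f\in M\dot K^{\alpha,\lambda}_{p_1,\vec q_1}(\mathbb R^n)$.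
   Context: For $1<l<\infty$ and $\frac1l+\frac1{l'}=1$, the fractional maximal commutator of $b\in BMO(\mathbb R^n)$ is $$M_b^lf(x)=\sup_{r>0}|B(x,r)|^{-1/l'}\int_{B(x,r)}|b(x)-b(y)||f(y)|\,dy,\qquad B(x,r)=\{y\in\mathbb R^n:|x-y|\le r\}.$$ For $k\in\mathbb Z$: $B_k=\{x\in\mathbb R^n:|x|\le 2^k\}$, $A_k=B_k\setminus B_{k-1}$, $\chi_k=\chi_{A_k}$ (characteristic function). Mixed Lebesgue space: for $\vec q=(q_1,\dots,q_n)\in(0,\infty)^n$, $L^{\vec q}(\mathbb R^n)$ is the set of measurable $f$ with $$\|f\|_{L^{\vec q}}=\Big(\int_{\mathbb R}\cdots\Big(\int_{\mathbb R}\Big(\int_{\mathbb R}|f(x_1,\dots,x_n)|^{q_1}dx_1\Big)^{q_2/q_1}dx_2\Big)^{q_3/q_2}\cdots dx_n\Big)^{1/q_n}<\infty.$$ Homogeneous mixed Herz-Morrey space: for $\alpha\in\mathbb R$, $0<p\le\infty$, $0\le\lambda<\infty$, $\vec q\in[1,\infty)^n$, $M\dot K^{\alpha,\lambda}_{p,\vec q}(\mathbb R^n)$ is the set of $f\in L^{\vec q}_{loc}(\mathbb R^n\setminus\{0\})$ with $$\|f\|_{M\dot K^{\alpha,\lambda}_{p,\vec q}}=\sup_{k_0\in\mathbb Z}2^{-k_0\lambda}\Big\{\sum_{k=-\infty}^{k_0}2^{k\alpha p}\|f\chi_k\|_{L^{\vec q}}^p\Big\}^{1/p}<\infty,$$ where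 for $p=\infty$ the expression $\{\cdot\}^{1/p}$ is replaced by $\sup_{k\le k_0}2^{k\alpha}\|f\chi_k\|_{L^{\vec q}}$. *)

theory Defs
  imports "HOL-Analysis.Analysis"
begin

text \<open>
  The space of n-dimensional vectors is rendered as \<open>real ^ 'n\<close> with \<open>'n :: {finite, linorder}\<close>;
  the linear order on the index type fixes the order \<open>x\<^sub>1, \<dots>, x\<^sub>n\<close> of the coordinates, which
  matters for the iterated integrals. Functions take values in the extended reals, so that
  a maximal function, which may be infinite at some points, is again a function of this kind.
\<close>

text \<open>Powers of extended nonnegative reals; used for exponents \<open>a > 0\<close> only.\<close>

definition ennpowr :: "ennreal \<Rightarrow> real \<Rightarrow> ennreal" where
  "ennpowr x a = (if x = \<infinity> then \<infinity> else ennreal (enn2real x powr a))"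

text \<open>
  \<open>mixed_iter q r is F\<close> integrates \<open>F\<close> over the coordinates listed in \<open>is\<close>, head first, where \<open>r\<close>
  is the exponent belonging to the integration carried out last (1 at the beginning): each step
  raises to the power \<open>q\<^sub>i / r\<close> and integrates over \<open>x\<^sub>i\<close>, and at the end the root of the last exponent
  is taken. Once all coordinates have been integrated, the result no longer depends on the
  point argument, which is therefore evaluated at 0 in \<open>mixed_norm\<close>.
\<close>

fun mixed_iter ::
  "real ^ 'n \<Rightarrow> real \<Rightarrow> 'n list \<Rightarrow> (real ^ 'n \<Rightarrow> ennreal) \<Rightarrow> real ^ 'n \<Rightarrow> ennreal" where
  "mixed_iter q r [] F = (\<lambda>x. ennpowr (F x) (1 / r))"
| "mixed_iter q r (i # is) F =
     mixed_iter q (q $ i) is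
       (\<lambda>x. \<integral>\<^sup>+t. ennpowr (F (\<chi> j. if j = i then t else x $ j)) (q $ i / r) \<partial>lebesgue)"

definition mixed_norm :: "real ^ 'n::{finite,linorder} \<Rightarrow> (real ^ 'n::{finite,linorder} \<Rightarrow> ereal) \<Rightarrow> ennreal" where
  "mixed_norm q f = mixed_iter q 1 (sorted_list_of_set UNIV) (\<lambda>x. e2ennreal \<bar>f x\<bar>) 0"

definition mixed_lebesgue :: "real ^ 'n::{finite,linorder} \<Rightarrow> (real ^ 'n::{finite,linorder} \<Rightarrow> ereal) set" where
  "mixed_lebesgue q = {f. f \<in> borel_measurable lebesgue \<and> mixed_norm q f < \<infinity>}"

definition mixed_lebesgue_loc ::
  "(real ^ 'n::{finite,linorder}) set \<Rightarrow> real ^ 'n::{finite,linorder} \<Rightarrow> (real ^ 'n::{finite,linorder} \<Rightarrow> ereal) set" where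
  "mixed_lebesgue_loc \<Omega> q =
     {f. \<forall>K. compact K \<and> K \<subseteq> \<Omega> \<longrightarrow> (\<lambda>x. f x * indicator K x) \<in> mixed_lebesgue q}"

definition dyadic_ball :: "int \<Rightarrow> (real ^ 'n) set" where
  "dyadic_ball k = {x. norm x \<le> 2 powi k}"

definition dyadic_shell :: "int \<Rightarrow> (real ^ 'n) set" where
  "dyadic_shell k = dyadic_ball k - dyadic_ball (k - 1)"

definition shell_norm ::
  "real ^ 'n::{finite,linorder} \<Rightarrow> (real ^ 'n::{finite,linorder} \<Rightarrow> ereal) \<Rightarrow> int \<Rightarrow> ennreal" where
  "shell_norm q f k = mixed_norm q (\<lambda>x. f x * indicator (dyadic_shell k) x)"

definition herz_morrey_norm ::
  "real \<Rightarrow> real \<Rightarrow> ennreal \<Rightarrow> real ^ 'n::{finite,linorder} \<Rightarrow> (real ^ 'n::{finite,linorder} \<Rightarrow> ereal) \<Rightarrow> ennreal" where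
  "herz_morrey_norm \<alpha> lam p q f =
     (SUP k0::int. ennreal (2 powr (- of_int k0 * lam)) *
        (if p = \<infinity>
         then (SUP k\<in>{..k0}. ennreal (2 powr (of_int k * \<alpha>)) * shell_norm q f k)
         else ennpowr
                (\<Sum>\<^sub>\<infinity>k\<in>{..k0}. ennreal (2 powr (of_int k * \<alpha> * enn2real p)) *
                                ennpowr (shell_norm q f k) (enn2real p))
                (1 / enn2real p)))"

definition herz_morrey ::
  "real \<Rightarrow> real \<Rightarrow> ennreal \<Rightarrow> real ^ 'n::{finite,linorder} \<Rightarrow> (real ^ 'n::{finite,linorder} \<Rightarrow> ereal) set" where
  "herz_morrey \<alpha> lam p q =
     {f. f \<in> mixed_lebesgue_loc (- {0}) q \<and> herz_morrey_norm \<alpha> lam p q f < \<infinity>}"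

definition mean_on :: "(real ^ 'n) set \<Rightarrow> (real ^ 'n \<Rightarrow> real) \<Rightarrow> real" where
  "mean_on B b = (LINT y:B|lebesgue. b y) / measure lebesgue B"

definition bmo :: "(real ^ 'n \<Rightarrow> real) set" where
  "bmo = {b. (\<forall>K. compact K \<longrightarrow> set_integrable lebesgue K b) \<and>
             (\<exists>C. \<forall>c. \<forall>r>0. mean_on (cball c r) (\<lambda>y. \<bar>b y - mean_on (cball c r) b\<bar>) \<le> C)}"

text \<open>The conjugate exponent \<open>l'\<close> enters through \<open>1 / l' = 1 - 1 / l\<close>.\<close>

definition frac_max_comm ::
  "real \<Rightarrow> (real ^ 'n \<Rightarrow> real) \<Rightarrow> (real ^ 'n \<Rightarrow> ereal) \<Rightarrow> real ^ 'n \<Rightarrow> ereal" where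
  "frac_max_comm l b f x =
     enn2ereal (SUP r\<in>{0<..}.
       ennreal (measure lebesgue (cball x r) powr (- (1 - 1 / l))) *
       (\<integral>\<^sup>+y\<in>cball x r. ennreal \<bar>b x - b y\<bar> * e2ennreal \<bar>f y\<bar> \<partial>lebesgue))"

definition bounded_operator ::
  "('f \<Rightarrow> 'g) \<Rightarrow> 'f set \<Rightarrow> ('f \<Rightarrow> ennreal) \<Rightarrow> 'g set \<Rightarrow> ('g \<Rightarrow> ennreal) \<Rightarrow> bool" where
  "bounded_operator T X normX Y normY \<longleftrightarrow>
     (\<exists>C::real. \<forall>f\<in>X. T f \<in> Y \<and> normY (T f) \<le> ennreal C * normX f)"

end

theory Submission
  imports Defs
begin

text \<open>
  Write \<open>T g x = \<integral> \<bar>b x - b y\<bar> g y dy\<close>. On \<open>A\<^sub>k\<close>, the maximal function of a \<open>g\<close> supported in \<open>A\<^sub>j\<close> with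
  \<open>\<bar>j - k\<bar> \<ge> 2\<close> is comparable to \<open>2\<^bsup>-mn/l'\<^esup> T g\<close>, where \<open>m = max j k\<close>. Averaging
  \<open>\<bar>b x - b y\<bar> \<le> \<bar>b x - b z\<bar> + \<bar>b z - b y\<bar>\<close> over \<open>z \<in> B\<^sub>j\<close> bounds \<open>T g\<close> by mean oscillations of \<open>b\<close>.
  No John-Nirenberg inequality is needed to control these: the assumed boundedness from \<open>L\<^bsup>q1\<^esup>\<close> to
  \<open>L\<^bsup>q2\<^esup>\<close>, tested on indicators of balls and on functions supported in \<open>B\<^sub>j\<close>, already gives
  the required mixed-norm bounds, and the oscillation between \<open>B\<^sub>j\<close> and \<open>B\<^sub>k\<close> grows at most linearly
  in \<open>\<bar>j - k\<bar>\<close> by comparing consecutive balls. The result is a bound of the sequence \<open>\<parallel>\<chi>\<^sub>k M f\<parallel>\<close>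
  by a convolution of \<open>\<parallel>f \<chi>\<^sub>j\<parallel>\<close> with a kernel whose exponential decay survives the weights
  \<open>2\<^bsup>k\<alpha>\<^esup>\<close> and \<open>2\<^bsup>-k\<lambda>\<^esup>\<close> exactly in the stated range of \<open>\<alpha>\<close>.
\<close>

section \<open>Mixed norms as iterated one-dimensional norms\<close>

text \<open>The hypothesis is tested in two ways. On the indicator of B_k it bounds the L^q2 norm
  over B_k of the oscillation of b about a point; on g supported in B_j, followed by Hoelder's
  inequality, it bounds the pairing of g with that oscillation, which amounts to a bound in the dual
  of L^q1. Together they cover both terms produced by averaging over an intermediate ball: one
  depends on x only through the oscillation, the other not at all. Measurability is the second
  concern. Functions are Lebesgue measurable, but iterated integrals look at single slices, which
  may then fail to be measurable; algebraic properties of the mixed norm are therefore proved for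
  Borel functions and carried over by a.e. monotonicity. Membership in the target space also asks
  that M f be measurable, whereas the hypothesis speaks of f in L^q1 only. Truncations of f to
  compact annuli around the origin do lie in L^q1, and M f is the supremum of their maximal
  functions.\<close>

lemma ennpowr_top [simp]: "ennpowr top a = top"
  by (simp add: ennpowr_def infinity_ennreal_def)

lemma ennpowr_ennreal [simp]: "0 \<le> x \<Longrightarrow> ennpowr (ennreal x) a = ennreal (x powr a)"
  by (simp add: ennpowr_def infinity_ennreal_def)

lemma ennpowr_0 [simp]: "ennpowr 0 a = 0"
  by (simp add: ennpowr_def infinity_ennreal_def)

lemma ennpowr_1 [simp]: "ennpowr 1 a = 1"
  by (simp add: ennpowr_def infinity_ennreal_def)

lemma ennpowr_one [simp]: "ennpowr x 1 = x"
  by (cases x) auto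

lemma ennpowr_ennpowr: "ennpowr (ennpowr x a) b = ennpowr x (a * b)"
  by (cases x) (auto simp: powr_powr)

lemma ennpowr_mono: "0 \<le> a \<Longrightarrow> x \<le> y \<Longrightarrow> ennpowr x a \<le> ennpowr y a"
  by (cases x; cases y) (auto simp: powr_mono2 top_unique)

lemma ennpowr_mult: "0 < a \<Longrightarrow> ennpowr (x * y) a = ennpowr x a * ennpowr y a"
proof -
  have *: "ennpowr (top * z) a = top * ennpowr z a" if "0 < a" for z
    by (cases z) (auto simp: ennreal_top_mult)
  assume "0 < a"
  then show ?thesis
    using *[of x] *[of y]
    by (cases x; cases y) (auto simp: powr_mult ennreal_mult[symmetric] mult.commute)
qed

lemma ennpowr_eq_0_iff: "0 < a \<Longrightarrow> ennpowr x a = 0 \<longleftrightarrow> x = 0"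
  by (cases x) auto

lemma ennpowr_eq_top_iff [simp]: "ennpowr x a = top \<longleftrightarrow> x = top"
  by (cases x) auto

lemma ennpowr_less_top_iff [simp]: "ennpowr x a < top \<longleftrightarrow> x < top"
  by (simp add: less_top[symmetric])

lemma ennpowr_le_iff:
  assumes "0 < a"
  shows "ennpowr x a \<le> y \<longleftrightarrow> x \<le> ennpowr y (1 / a)"
  using ennpowr_mono[of "1 / a" "ennpowr x a" y] ennpowr_mono[of a x "ennpowr y (1 / a)"] assms
  by (auto simp: ennpowr_ennpowr)

text \<open>By \<open>ennpowr_le_iff\<close> the powers a and 1/a are mutually inverse order maps,
  so suprema are preserved.\<close>

lemma ennpowr_SUP:
  assumes "0 < a"
  shows "ennpowr (SUP i\<in>I. f i) a = (SUP i\<in>I. ennpowr (f i) a)"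
proof (rule antisym)
  show "ennpowr (SUP i\<in>I. f i) a \<le> (SUP i\<in>I. ennpowr (f i) a)"
    unfolding ennpowr_le_iff[OF assms]
    by (rule SUP_least, subst ennpowr_le_iff[OF assms, symmetric]) (rule SUP_upper)
  show "(SUP i\<in>I. ennpowr (f i) a) \<le> ennpowr (SUP i\<in>I. f i) a"
    using assms by (auto intro!: SUP_least ennpowr_mono SUP_upper)
qed

lemma ennpowr_add_exponent: "x \<noteq> 0 \<Longrightarrow> ennpowr x (a + b) = ennpowr x a * ennpowr x b"
  by (cases x) (auto simp: powr_add ennreal_mult)

lemma borel_measurable_ennpowr [measurable]:
  "f \<in> borel_measurable M \<Longrightarrow> (\<lambda>x. ennpowr (f x) a) \<in> borel_measurable M"
proof -
  assume [measurable]: "f \<in> borel_measurable M"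
  have [measurable]: "{x \<in> space M. f x = top} \<in> sets M"
    using measurable_sets[of f M borel "{top}"] by (simp add: vimage_def Int_def conj_commute)
  show ?thesis
    unfolding ennpowr_def infinity_ennreal_def by (intro measurable_If powr_real_measurable) measurable
qed

text \<open>Convexity of the q-th power at the points x(A+B)/A and y(A+B)/B with weights A/(A+B) and
  B/(A+B): their average is x + y. In the integrated form A and B will be, up to a small error, the
  norms of the two summands.\<close>

lemma powr_add_le_weighted:
  fixes x y A B q :: real
  assumes "1 \<le> q" "0 \<le> x" "0 \<le> y" "0 < A" "0 < B"
  shows "(x + y) powr q \<le> ((A + B) / A) powr (q - 1) * x powr q + ((A + B) / B) powr (q - 1) * y powr q"
proof -
  have ge1: "z powr q \<le> c powr (q - 1) * z powr q" if "1 \<le> c" for c z :: real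
    using ge_one_powr_ge_zero[of c "q - 1"] that assms by (simp add: mult_le_cancel_right1)
  consider "x = 0" | "y = 0" | "0 < x" "0 < y" using assms by fastforce
  then show ?thesis
  proof cases
    case 1
    then show ?thesis using ge1[of "(A + B) / B" y] assms by (simp add: field_simps)
  next
    case 2
    then show ?thesis using ge1[of "(A + B) / A" x] assms by (simp add: field_simps)
  next
    case 3
    define S where "S = A + B"
    have S: "0 < S" using assms by (simp add: S_def)
    have AB: "A / S + B / S = 1" using S by (simp add: S_def add_divide_distrib[symmetric])
    have wt: "a / S * (x * S / a) powr q = (S / a) powr (q - 1) * x powr q"
      if "0 < a" "0 < x" for a x
    proof -
      have "(x * S / a) powr q = (S / a) powr q * x powr q"
        using that S by (simp flip: powr_mult add: field_simps)
      also have "(S / a) powr q = (S / a) powr (q - 1) * (S / a)"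
        using powr_add[of "S / a" "q - 1" 1] that S by simp
      finally show ?thesis using that S by simp
    qed
    have "(A / S * (x * S / A) + B / S * (y * S / B)) powr q
        \<le> A / S * (x * S / A) powr q + B / S * (y * S / B) powr q"
    proof -
      have "1 - B / S = A / S" using AB by simp
      moreover have "0 \<le> B / S" "B / S \<le> 1" using AB assms S by (simp_all add: S_def)
      moreover have "0 < x * S / A" "0 < y * S / B" using 3 assms S by simp_all
      ultimately show ?thesis
        using convex_onD[OF powr_convex[OF assms(1)], of "B / S" "x * S / A" "y * S / B"] by simp
    qed
    then show ?thesis
      using wt[of A x] wt[of B y] assms 3 S by (simp add: S_def)
  qed
qed

text \<open>With A and B the norms of f and g, the two terms of \<open>powr_add_le_weighted\<close>
  integrate to at most A(A+B)^(q-1) and B(A+B)^(q-1), which add up to (A+B)^q.\<close>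

lemma nn_integral_Minkowski:
  assumes [measurable]: "f \<in> borel_measurable M" "g \<in> borel_measurable M" and q: "1 \<le> q"
  shows "ennpowr (\<integral>\<^sup>+x. ennpowr (f x + g x) q \<partial>M) (1 / q)
       \<le> ennpowr (\<integral>\<^sup>+x. ennpowr (f x) q \<partial>M) (1 / q) + ennpowr (\<integral>\<^sup>+x. ennpowr (g x) q \<partial>M) (1 / q)"
    (is "?N \<le> ?X + ?Y")
proof (rule ennreal_le_epsilon)
  fix e :: real assume e: "0 < e" and fin: "?X + ?Y < top"
  obtain u v where u: "?X = ennreal u" "0 \<le> u" and v: "?Y = ennreal v" "0 \<le> v"
    using fin by (cases ?X; cases ?Y) auto
  \<comment> \<open>Adding e/2 keeps the weights positive when a norm vanishes; the slack is removed
    by \<open>ennreal_le_epsilon\<close>.\<close>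
  define A B where "A = u + e / 2" and "B = v + e / 2"
  have AB: "0 < A" "0 < B" using u v e by (auto simp: A_def B_def)
  have bound: "(\<integral>\<^sup>+x. ennpowr (h x) q \<partial>M) \<le> ennreal (a powr q)"
    if "ennpowr (\<integral>\<^sup>+x. ennpowr (h x) q \<partial>M) (1 / q) = ennreal c" "0 \<le> c" "c \<le> a" for h a c
    using that q ennpowr_le_iff[of "1 / q" "\<integral>\<^sup>+x. ennpowr (h x) q \<partial>M" "ennreal a"] by auto
  define c1 c2 where "c1 = ((A + B) / A) powr (q - 1)" and "c2 = ((A + B) / B) powr (q - 1)"
  have c: "0 < c1" "0 < c2" using AB by (auto simp: c1_def c2_def)
  have pw: "ennpowr (f x + g x) q \<le> ennreal c1 * ennpowr (f x) q + ennreal c2 * ennpowr (g x) q" for x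
  proof (cases "f x = top \<or> g x = top")
    case True
    then show ?thesis using c by (auto simp: ennreal_mult_top ennreal_mult_eq_top_iff)
  next
    case False
    then obtain s t where st: "f x = ennreal s" "0 \<le> s" "g x = ennreal t" "0 \<le> t"
      by (metis ennreal_cases)
    show ?thesis
      using powr_add_le_weighted[of q s t A B] st q AB c
      by (simp add: ennreal_plus[symmetric] ennreal_mult[symmetric] c1_def c2_def del: ennreal_plus)
  qed
  have pe: "((A + B) / z) powr (q - 1) * z powr q = z * (A + B) powr (q - 1)" if "0 < z" for z
  proof -
    have "z powr q = z powr (q - 1) * z" using powr_add[of z "q - 1" 1] that by simp
    moreover have "((A + B) / z) powr (q - 1) * z powr (q - 1) = (A + B) powr (q - 1)"
      using that AB by (simp flip: powr_mult)
    ultimately show ?thesis by (simp add: mult.assoc[symmetric] mult.commute)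
  qed
  have "(\<integral>\<^sup>+x. ennpowr (f x + g x) q \<partial>M)
      \<le> (\<integral>\<^sup>+x. ennreal c1 * ennpowr (f x) q + ennreal c2 * ennpowr (g x) q \<partial>M)"
    by (intro nn_integral_mono pw)
  also have "\<dots> = ennreal c1 * (\<integral>\<^sup>+x. ennpowr (f x) q \<partial>M) + ennreal c2 * (\<integral>\<^sup>+x. ennpowr (g x) q \<partial>M)"
    by (simp add: nn_integral_add nn_integral_cmult)
  also have "\<dots> \<le> ennreal c1 * ennreal (A powr q) + ennreal c2 * ennreal (B powr q)"
    using u v e bound[of f u A] bound[of g v B] by (intro add_mono mult_left_mono) (auto simp: A_def B_def)
  also have "\<dots> = ennreal (c1 * A powr q + c2 * B powr q)"
    using c by (simp add: ennreal_mult)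
  also have "c1 * A powr q + c2 * B powr q = (A + B) powr (1 + (q - 1))"
    using AB by (subst powr_add) (use pe[of A] pe[of B] AB in \<open>simp add: c1_def c2_def algebra_simps\<close>)
  finally have "?N \<le> ennreal (A + B)"
    using q AB ennpowr_le_iff[of "1 / q" _ "ennreal (A + B)"] by (simp del: ennreal_plus)
  then show "?N \<le> ?X + ?Y + ennreal e"
    using u v e by (simp add: A_def B_def ennreal_plus[symmetric] add.commute add.left_commute del: ennreal_plus)
qed

text \<open>The root is taken at every stage, not deferred to the next power as in
  \<open>mixed_iter\<close>; each stage is then a norm in one variable, so its properties pass
  through the iteration one coordinate at a time. The result still takes a full point as argument
  but ignores its i-th coordinate.\<close>

definition slice_norm :: "real \<Rightarrow> 'n \<Rightarrow> (real ^ 'n \<Rightarrow> ennreal) \<Rightarrow> real ^ 'n \<Rightarrow> ennreal" where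
  "slice_norm q i F x =
     ennpowr (\<integral>\<^sup>+t. ennpowr (F (\<chi> j. if j = i then t else x $ j)) q \<partial>lborel) (1 / q)"

definition mixed_nn_norm ::
  "real ^ 'n::{finite,linorder} \<Rightarrow> (real ^ 'n::{finite,linorder} \<Rightarrow> ennreal) \<Rightarrow> ennreal" where
  "mixed_nn_norm q F = fold (\<lambda>i. slice_norm (q $ i) i) (sorted_list_of_set UNIV) F 0"

text \<open>The power \<open>q $ i / r\<close> is the root 1/r closing the previous stage followed
  by the power opening the next; the integrals agree because a measure and its completion have the
  same nonnegative integrals.\<close>

lemma mixed_iter_eq_fold:
  assumes "\<And>i. i \<in> set is \<Longrightarrow> 0 < q $ i" "0 < r"
  shows "mixed_iter q r is F = fold (\<lambda>i. slice_norm (q $ i) i) is (\<lambda>x. ennpowr (F x) (1 / r))"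
  using assms
proof (induction "is" arbitrary: r F)
  case (Cons i "is")
  then show ?case
    by (simp add: nn_integral_completion slice_norm_def[abs_def] ennpowr_ennpowr)
qed simp

lemma mixed_norm_eq:
  assumes "\<And>i. 0 < q $ i"
  shows "mixed_norm q f = mixed_nn_norm q (\<lambda>x. e2ennreal \<bar>f x\<bar>)"
  using assms by (simp add: mixed_norm_def mixed_nn_norm_def mixed_iter_eq_fold)

section \<open>Measurability, monotonicity and Minkowski for slice norms\<close>

lemma continuous_vec_update:
  "continuous_on UNIV (\<lambda>p::(real ^ 'n) \<times> real. (\<chi> j. if j = i then snd p else fst p $ j) :: real ^ 'n)"
proof (intro continuous_on_vec_lambda)
  fix j
  show "continuous_on UNIV (\<lambda>p::(real ^ 'n) \<times> real. if j = i then snd p else fst p $ j)"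
    by (cases "j = i") (auto intro!: continuous_intros)
qed

lemma measurable_vec_update [measurable]:
  "(\<lambda>p::(real ^ 'n) \<times> real. (\<chi> j. if j = i then snd p else fst p $ j) :: real ^ 'n) \<in> borel \<Otimes>\<^sub>M borel \<rightarrow>\<^sub>M borel"
  using borel_measurable_continuous_onI[OF continuous_vec_update] by (simp add: borel_prod)

lemma measurable_vec_update1 [measurable]:
  "(\<lambda>t. (\<chi> j. if j = i then t else x $ j) :: real ^ 'n) \<in> borel \<rightarrow>\<^sub>M borel"
proof (intro borel_measurable_continuous_onI continuous_on_vec_lambda)
  fix j
  show "continuous_on UNIV (\<lambda>t. if j = i then t else x $ j)"
    by (cases "j = i") (auto intro!: continuous_intros)
qed

lemma borel_measurable_slice_norm [measurable]:
  assumes [measurable]: "F \<in> borel_measurable borel"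
  shows "slice_norm q i F \<in> borel_measurable borel"
proof -
  have "(\<lambda>p. F (\<chi> j. if j = i then snd p else fst p $ j)) \<in> borel_measurable (borel \<Otimes>\<^sub>M borel)"
    by measurable
  then have [measurable]: "case_prod (\<lambda>x t. F (\<chi> j. if j = i then t else x $ j)) \<in> borel_measurable (borel \<Otimes>\<^sub>M lborel)"
    by (simp add: case_prod_beta')
  show ?thesis unfolding slice_norm_def[abs_def] by measurable
qed

lemma slice_norm_mono: "0 < q \<Longrightarrow> (\<And>x. F x \<le> G x) \<Longrightarrow> slice_norm q i F x \<le> slice_norm q i G x"
  unfolding slice_norm_def by (auto intro!: ennpowr_mono nn_integral_mono)

lemma slice_norm_cmult:
  assumes [measurable]: "F \<in> borel_measurable borel" and "0 < q"
  shows "slice_norm q i (\<lambda>x. c * F x) = (\<lambda>x. c * slice_norm q i F x)"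
  using assms by (auto simp: slice_norm_def ennpowr_mult nn_integral_cmult ennpowr_ennpowr)

lemma slice_norm_add:
  assumes [measurable]: "F \<in> borel_measurable borel" "G \<in> borel_measurable borel" and "1 \<le> q"
  shows "slice_norm q i (\<lambda>x. F x + G x) x \<le> slice_norm q i F x + slice_norm q i G x"
  unfolding slice_norm_def using assms by (intro nn_integral_Minkowski) measurable

lemma slice_norm_SUP:
  assumes [measurable]: "\<And>m::nat. F m \<in> borel_measurable borel" and "incseq F" "0 < q"
  shows "slice_norm q i (\<lambda>x. SUP m. F m x) = (\<lambda>x. SUP m. slice_norm q i (F m) x)"
proof
  fix x
  have "incseq (\<lambda>m t. ennpowr (F m (\<chi> j. if j = i then t else x $ j)) q)"
    using assms by (auto simp: incseq_def le_fun_def intro!: ennpowr_mono)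
  then show "slice_norm q i (\<lambda>x. SUP m. F m x) x = (SUP m. slice_norm q i (F m) x)"
    using assms by (simp add: slice_norm_def ennpowr_SUP nn_integral_monotone_convergence_SUP)
qed

text \<open>
  Translation invariance of Lebesgue measure on \<open>real ^ 'n\<close> along the \<open>i\<close>-th axis replaces the
  decomposition of that measure as a product; with \<open>\<phi>\<close> the indicator of the unit interval this is
  one step of the Tonelli theorem, with \<open>\<phi> = 1\<close> it shows that almost all slices of a null set are null.
\<close>

lemma nn_integral_slice:
  fixes h :: "real ^ 'n \<Rightarrow> ennreal" and \<phi> :: "real \<Rightarrow> ennreal"
  assumes [measurable]: "h \<in> borel_measurable borel" "\<phi> \<in> borel_measurable borel"
  shows "(\<integral>\<^sup>+x. \<phi> (x $ i) * (\<integral>\<^sup>+t. h (\<chi> j. if j = i then t else x $ j) \<partial>lborel) \<partial>lborel)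
       = (\<integral>\<^sup>+t. \<phi> t \<partial>lborel) * (\<integral>\<^sup>+x. h x \<partial>lborel)"
proof -
  define e where "e = (axis i 1 :: real ^ 'n)"
  have nth [measurable]: "(\<lambda>x::real ^ 'n. x $ i) \<in> borel_measurable borel"
    by (intro borel_measurable_continuous_onI continuous_intros)
  have upd: "(\<chi> j. if j = i then x $ i + 1 * t else x $ j) = x + t *\<^sub>R e" for x :: "real ^ 'n" and t
    by (simp add: vec_eq_iff e_def axis_def)
  have "(\<integral>\<^sup>+t. h (\<chi> j. if j = i then t else x $ j) \<partial>lborel) = (\<integral>\<^sup>+t. h (x + t *\<^sub>R e) \<partial>lborel)" for x
    using nn_integral_real_affine[of "\<lambda>t. h (\<chi> j. if j = i then t else x $ j)" 1 "x $ i"]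
    unfolding upd by (simp add: one_ennreal_def[symmetric])
  then have "(\<integral>\<^sup>+x. \<phi> (x $ i) * (\<integral>\<^sup>+t. h (\<chi> j. if j = i then t else x $ j) \<partial>lborel) \<partial>lborel)
      = (\<integral>\<^sup>+x. \<integral>\<^sup>+t. \<phi> (x $ i) * h (x + t *\<^sub>R e) \<partial>lborel \<partial>lborel)"
    by (simp add: nn_integral_cmult)
  also have "\<dots> = (\<integral>\<^sup>+t. \<integral>\<^sup>+x. \<phi> (x $ i) * h (x + t *\<^sub>R e) \<partial>lborel \<partial>lborel)"
    by (rule lborel_pair.Fubini'[symmetric]) measurable
  also have "\<dots> = (\<integral>\<^sup>+t. \<integral>\<^sup>+x. \<phi> (x $ i - t) * h x \<partial>lborel \<partial>lborel)"
  proof (rule nn_integral_cong)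
    fix t
    have "(\<integral>\<^sup>+x. \<phi> (x $ i - t) * h x \<partial>lborel)
        = (\<integral>\<^sup>+x. \<phi> (x $ i - t) * h x \<partial>distr lborel borel ((+) (t *\<^sub>R e)))"
      by (simp add: lborel_distr_plus)
    also have "\<dots> = (\<integral>\<^sup>+x. \<phi> (x $ i) * h (x + t *\<^sub>R e) \<partial>lborel)"
      by (subst nn_integral_distr) (simp_all add: e_def axis_def add.commute)
    finally show "(\<integral>\<^sup>+x. \<phi> (x $ i) * h (x + t *\<^sub>R e) \<partial>lborel) = (\<integral>\<^sup>+x. \<phi> (x $ i - t) * h x \<partial>lborel)" ..
  qed
  also have "\<dots> = (\<integral>\<^sup>+x. \<integral>\<^sup>+t. \<phi> (x $ i - t) * h x \<partial>lborel \<partial>lborel)"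
    by (rule lborel_pair.Fubini') measurable
  also have "\<dots> = (\<integral>\<^sup>+x. (\<integral>\<^sup>+t. \<phi> t \<partial>lborel) * h x \<partial>lborel)"
  proof (rule nn_integral_cong)
    fix x :: "real ^ 'n"
    have "(\<integral>\<^sup>+t. \<phi> t \<partial>lborel) = (\<integral>\<^sup>+t. \<phi> (x $ i - t) \<partial>lborel)"
      using nn_integral_real_affine[of \<phi> "-1" "x $ i"] by (simp add: one_ennreal_def[symmetric])
    then show "(\<integral>\<^sup>+t. \<phi> (x $ i - t) * h x \<partial>lborel) = (\<integral>\<^sup>+t. \<phi> t \<partial>lborel) * h x"
      by (simp add: nn_integral_multc)
  qed
  finally show ?thesis by (simp add: nn_integral_cmult)
qed

lemma AE_slice_notin_null:
  fixes N :: "(real ^ 'n) set"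
  assumes "N \<in> null_sets lborel"
  shows "AE x in lborel. AE t in lborel. (\<chi> j. if j = i then t else x $ j) \<notin> N"
proof -
  have [measurable]: "N \<in> sets borel" using assms by (auto simp: null_sets_def)
  have "(\<integral>\<^sup>+x. (\<integral>\<^sup>+t. indicator N (\<chi> j. if j = i then t else x $ j) \<partial>lborel) \<partial>(lborel :: (real ^ 'n) measure)) = 0"
    using nn_integral_slice[of "indicator N" "\<lambda>_. 1" i] assms by (simp add: null_sets_def)
  moreover have [measurable]: "case_prod (\<lambda>x t. indicator N (\<chi> j. if j = i then t else x $ j))
      \<in> borel_measurable (lborel \<Otimes>\<^sub>M (lborel :: real measure))"
    by (simp add: case_prod_beta')
  ultimately have "AE x in lborel. (\<integral>\<^sup>+t. indicator N (\<chi> j. if j = i then t else x $ j) \<partial>lborel) = 0"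
    by (subst (asm) nn_integral_0_iff_AE) measurable
  then show ?thesis
    by eventually_elim (auto simp: nn_integral_0_iff_AE indicator_def)
qed

text \<open>The exceptional null set meets almost every line parallel to the i-th axis in a null
  set, so on almost every line the integrands compare a.e.\<close>

lemma AE_slice_norm_mono:
  assumes "AE x in lborel. F x \<le> G x" "0 < q"
  shows "AE x in lborel. slice_norm q i F x \<le> slice_norm q i G x"
proof -
  obtain N where N: "N \<in> null_sets lborel" "\<And>x. x \<notin> N \<Longrightarrow> F x \<le> G x"
    using assms(1) by (auto simp: eventually_ae_filter subset_eq)
  have "AE x in lborel. AE t in lborel. (\<chi> j. if j = i then t else x $ j) \<notin> N"
    by (rule AE_slice_notin_null[OF N(1)])
  then show ?thesis
  proof eventually_elim
    case (elim x)
    from elim have "AE t in lborel. ennpowr (F (\<chi> j. if j = i then t else x $ j)) q \<le> ennpowr (G (\<chi> j. if j = i then t else x $ j)) q"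
      by eventually_elim (use N assms in \<open>auto intro!: ennpowr_mono\<close>)
    then show ?case
      unfolding slice_norm_def using assms by (intro ennpowr_mono nn_integral_mono_AE) auto
  qed
qed

abbreviation fold_slice :: "real ^ 'n \<Rightarrow> 'n list \<Rightarrow> (real ^ 'n \<Rightarrow> ennreal) \<Rightarrow> real ^ 'n \<Rightarrow> ennreal" where
  "fold_slice q \<equiv> fold (\<lambda>i. slice_norm (q $ i) i)"

lemma AE_fold_slice_mono:
  assumes "\<And>i. 0 < q $ i" "AE x in lborel. F x \<le> G x"
  shows "AE x in lborel. fold_slice q is F x \<le> fold_slice q is G x"
  using assms(2)
  by (induction "is" arbitrary: F G) (simp_all add: AE_slice_norm_mono assms(1))

lemma slice_norm_indep:
  assumes "\<forall>x y. (\<forall>j. j \<notin> S \<longrightarrow> x $ j = y $ j) \<longrightarrow> F x = F y"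
    and "\<forall>j. j \<notin> insert i S \<longrightarrow> x $ j = y $ j"
  shows "slice_norm q i F x = slice_norm q i F y"
proof -
  have "F (\<chi> j. if j = i then t else x $ j) = F (\<chi> j. if j = i then t else y $ j)" for t
    using assms(2) by (intro assms(1)[rule_format]) auto
  then show ?thesis by (simp add: slice_norm_def)
qed

text \<open>S holds the coordinates that the function already ignores; each stage adds its own. Once
  all are used the fold is constant, so the point 0 chosen in the definition is immaterial.\<close>

lemma fold_slice_indep:
  assumes "\<forall>x y. (\<forall>j. j \<notin> S \<longrightarrow> x $ j = y $ j) \<longrightarrow> F x = F y"
    and "\<forall>j. j \<notin> S \<union> set is \<longrightarrow> x $ j = y $ j"
  shows "fold_slice q is F x = fold_slice q is F y"
  using assms
proof (induction "is" arbitrary: S F)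
  case (Cons i "is")
  have "\<forall>x y. (\<forall>j. j \<notin> insert i S \<longrightarrow> x $ j = y $ j) \<longrightarrow>
      slice_norm (q $ i) i F x = slice_norm (q $ i) i F y"
    using slice_norm_indep[OF Cons.prems(1)] by blast
  moreover have "\<forall>j. j \<notin> insert i S \<union> set is \<longrightarrow> x $ j = y $ j"
    using Cons.prems(2) by simp
  ultimately have "fold_slice q is (slice_norm (q $ i) i F) x = fold_slice q is (slice_norm (q $ i) i F) y"
    by (rule Cons.IH)
  then show ?case by simp
qed (simp add: vec_eq_iff)

lemma fold_slice_eq_mixed_nn_norm:
  "fold_slice q (sorted_list_of_set UNIV) F x = mixed_nn_norm q F"
proof -
  have "\<forall>x y. (\<forall>j. j \<notin> {} \<longrightarrow> x $ j = y $ j) \<longrightarrow> F x = F y"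
    by (auto intro!: arg_cong[of _ _ F] simp: vec_eq_iff)
  from fold_slice_indep[OF this, of "sorted_list_of_set UNIV" x 0 q]
  show ?thesis by (simp only: mixed_nn_norm_def set_sorted_list_of_set[OF finite_class.finite_UNIV]) simp
qed

text \<open>After the last stage both sides are constants, and an a.e. inequality between constants
  holds outright since the space is not null.\<close>

lemma mixed_nn_norm_mono_AE:
  fixes F G :: "real ^ 'n::{finite,linorder} \<Rightarrow> ennreal"
  assumes "\<And>i. 0 < q $ i" "AE x in lebesgue. F x \<le> G x"
  shows "mixed_nn_norm q F \<le> mixed_nn_norm q G"
proof -
  have "AE x in (lborel :: (real ^ 'n::{finite,linorder}) measure). mixed_nn_norm q F \<le> mixed_nn_norm q G"
    using AE_fold_slice_mono[OF assms(1), of F G "sorted_list_of_set UNIV"] assms(2)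
    by (simp add: AE_completion_iff fold_slice_eq_mixed_nn_norm)
  moreover have "ae_filter (lborel :: (real ^ 'n::{finite,linorder}) measure) \<noteq> bot"
    by (simp add: ae_filter_eq_bot_iff)
  ultimately show ?thesis
    by (auto dest: eventually_happens')
qed

lemma mixed_nn_norm_mono:
  assumes "\<And>i. 0 < q $ i" "\<And>x. F x \<le> G x"
  shows "mixed_nn_norm q F \<le> mixed_nn_norm q G"
  using assms by (intro mixed_nn_norm_mono_AE) auto

text \<open>Since slices of F may be non-measurable, linearity and monotone convergence of the inner
  integrals are applied to F' instead. Two applications of \<open>mixed_nn_norm_mono_AE\<close> show
  that the norm does not notice the change.\<close>

lemma lebesgue_borel_representative:
  fixes F :: "real ^ 'n::{finite,linorder} \<Rightarrow> ennreal"
  assumes "\<And>i. 0 < q $ i" "F \<in> borel_measurable lebesgue"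
  obtains F' where "F' \<in> borel_measurable borel" "AE x in lebesgue. F x = F' x"
    "mixed_nn_norm q F = mixed_nn_norm q F'"
proof -
  obtain F' where F': "F' \<in> borel_measurable lborel" "AE x in lborel. F x = F' x"
    using completion_ex_borel_measurable[OF assms(2)] by blast
  then have ae: "AE x in lebesgue. F x = F' x" by (simp add: AE_completion)
  have "mixed_nn_norm q F = mixed_nn_norm q F'"
    using ae assms(1) by (intro antisym mixed_nn_norm_mono_AE) auto
  with F' ae that show ?thesis by simp
qed

lemma fold_slice_cmult:
  assumes "\<And>i. 0 < q $ i" "F \<in> borel_measurable borel"
  shows "fold_slice q is (\<lambda>x. c * F x) = (\<lambda>x. c * fold_slice q is F x)"
  using assms(2)
  by (induction "is" arbitrary: F) (simp_all add: borel_measurable_slice_norm slice_norm_cmult assms(1))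

text \<open>After one stage Minkowski leaves only an inequality, so the induction must run with an
  arbitrary H below F + G.\<close>

lemma fold_slice_add:
  assumes "\<And>i. 1 \<le> q $ i" "F \<in> borel_measurable borel" "G \<in> borel_measurable borel"
    and "\<And>x. H x \<le> F x + G x"
  shows "fold_slice q is H x \<le> fold_slice q is F x + fold_slice q is G x"
  using assms(2-)
proof (induction "is" arbitrary: F G H)
  case (Cons i "is")
  have "slice_norm (q $ i) i H x \<le> slice_norm (q $ i) i F x + slice_norm (q $ i) i G x" for x
    using slice_norm_mono[of "q $ i" H "\<lambda>x. F x + G x" i x] assms(1)[of i] Cons.prems
      slice_norm_add[of F G "q $ i" i x] by (meson order_trans less_le_trans zero_less_one)
  with Cons show ?case by (simp add: borel_measurable_slice_norm)
qed simp

lemma fold_slice_SUP: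
  assumes "\<And>i. 0 < q $ i" "\<And>m::nat. F m \<in> borel_measurable borel" "incseq F"
  shows "fold_slice q is (\<lambda>x. SUP m. F m x) = (\<lambda>x. SUP m. fold_slice q is (F m) x)"
  using assms(2-)
proof (induction "is" arbitrary: F)
  case (Cons i "is")
  have "incseq (\<lambda>m. slice_norm (q $ i) i (F m))"
    using incseqD[OF Cons.prems(2), THEN le_funD] assms(1)
    by (intro monoI le_funI slice_norm_mono)
  with Cons show ?case
    by (simp add: borel_measurable_slice_norm slice_norm_SUP assms(1))
qed simp

section \<open>Norm properties and monotone convergence of the mixed norm\<close>

lemma mixed_nn_norm_cmult:
  assumes "\<And>i. 0 < q $ i" "F \<in> borel_measurable lebesgue"
  shows "mixed_nn_norm q (\<lambda>x. c * F x) = c * mixed_nn_norm q F"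
proof -
  obtain F' where F': "F' \<in> borel_measurable borel" "AE x in lebesgue. F x = F' x"
    "mixed_nn_norm q F = mixed_nn_norm q F'"
    using lebesgue_borel_representative[of q F] assms by blast
  have "mixed_nn_norm q (\<lambda>x. c * F x) = mixed_nn_norm q (\<lambda>x. c * F' x)"
    using F'(2) assms(1) by (intro antisym mixed_nn_norm_mono_AE) auto
  with F' show ?thesis by (simp add: mixed_nn_norm_def fold_slice_cmult assms(1))
qed

lemma mixed_nn_norm_zero: "(\<And>i. 0 < q $ i) \<Longrightarrow> mixed_nn_norm q (\<lambda>x. 0) = 0"
  using mixed_nn_norm_cmult[of q "\<lambda>x. 0" 0] by simp

lemma mixed_nn_norm_add:
  assumes "\<And>i. 1 \<le> q $ i" "F \<in> borel_measurable lebesgue" "G \<in> borel_measurable lebesgue"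
  shows "mixed_nn_norm q (\<lambda>x. F x + G x) \<le> mixed_nn_norm q F + mixed_nn_norm q G"
proof -
  have q: "0 < q $ i" for i using assms(1)[of i] by simp
  obtain F' where F': "F' \<in> borel_measurable borel" "AE x in lebesgue. F x = F' x"
    "mixed_nn_norm q F = mixed_nn_norm q F'"
    using lebesgue_borel_representative[of q F] assms q by blast
  obtain G' where G': "G' \<in> borel_measurable borel" "AE x in lebesgue. G x = G' x"
    "mixed_nn_norm q G = mixed_nn_norm q G'"
    using lebesgue_borel_representative[of q G] assms q by blast
  have "mixed_nn_norm q (\<lambda>x. F x + G x) \<le> mixed_nn_norm q (\<lambda>x. F' x + G' x)"
    using F'(2) G'(2) q by (intro mixed_nn_norm_mono_AE) auto
  also have "\<dots> \<le> mixed_nn_norm q F' + mixed_nn_norm q G'"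
    unfolding mixed_nn_norm_def using assms(1) F' G' by (intro fold_slice_add) auto
  finally show ?thesis using F' G' by simp
qed

lemma mixed_nn_norm_sum:
  assumes "\<And>i. 1 \<le> q $ i" "\<And>m. m \<in> I \<Longrightarrow> F m \<in> borel_measurable lebesgue"
  shows "mixed_nn_norm q (\<lambda>x. \<Sum>m\<in>I. F m x) \<le> (\<Sum>m\<in>I. mixed_nn_norm q (F m))"
proof -
  have q: "0 < q $ i" for i using assms(1)[of i] by simp
  show ?thesis
    using assms(2)
  proof (induction I rule: infinite_finite_induct)
    case (insert m I)
    have "mixed_nn_norm q (\<lambda>x. \<Sum>m\<in>insert m I. F m x) = mixed_nn_norm q (\<lambda>x. F m x + (\<Sum>m\<in>I. F m x))"
      using insert by simp
    also have "\<dots> \<le> mixed_nn_norm q (F m) + mixed_nn_norm q (\<lambda>x. \<Sum>m\<in>I. F m x)"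
      using insert.prems assms(1) by (intro mixed_nn_norm_add borel_measurable_sum) auto
    also have "\<dots> \<le> mixed_nn_norm q (F m) + (\<Sum>m\<in>I. mixed_nn_norm q (F m))"
      using insert by (intro add_left_mono) auto
    finally show ?case using insert by simp
  qed (simp_all add: mixed_nn_norm_zero q)
qed

lemma mixed_nn_norm_SUP:
  assumes "\<And>i. 0 < q $ i" "\<And>m::nat. F m \<in> borel_measurable lebesgue" "incseq F"
  shows "mixed_nn_norm q (\<lambda>x. SUP m. F m x) = (SUP m. mixed_nn_norm q (F m))"
proof (rule antisym)
  have "\<exists>F'. F' \<in> borel_measurable borel \<and> (AE x in lebesgue. F m x = F' x)
    \<and> mixed_nn_norm q (F m) = mixed_nn_norm q F'" for m
    using lebesgue_borel_representative[of q "F m"] assms by metis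
  then obtain F' where F': "\<And>m. F' m \<in> borel_measurable borel" "\<And>m. AE x in lebesgue. F m x = F' m x"
    "\<And>m. mixed_nn_norm q (F m) = mixed_nn_norm q (F' m)"
    by metis
  note [measurable] = F'(1)
  \<comment> \<open>Representatives chosen separately for each m need not increase in m; the running
    maximum is Borel, increases everywhere, and still equals F a.e.\<close>
  define G where "G = (\<lambda>m x. SUP k\<in>{..m}. F' k x)"
  have G [measurable]: "G m \<in> borel_measurable borel" for m
    unfolding G_def by measurable
  have "incseq G"
    unfolding G_def by (auto simp: incseq_def le_fun_def intro!: SUP_subset_mono)
  have ae: "AE x in lebesgue. \<forall>m. F m x = F' m x"
    using F'(2) by (simp add: AE_all_countable)
  have GF: "AE x in lebesgue. \<forall>m. G m x = F m x"
    using ae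
  proof eventually_elim
    case (elim x)
    have "(SUP k\<in>{..m}. F k x) = F m x" for m
      using assms(3) by (auto simp: incseq_def le_fun_def intro!: antisym SUP_least SUP_upper)
    with elim show ?case by (simp add: G_def)
  qed
  have "mixed_nn_norm q (\<lambda>x. SUP m. F m x) \<le> mixed_nn_norm q (\<lambda>x. SUP m. G m x)"
    using GF assms(1) by (intro mixed_nn_norm_mono_AE) auto
  also have "\<dots> = (SUP m. mixed_nn_norm q (G m))"
    using \<open>incseq G\<close> assms(1) by (simp add: mixed_nn_norm_def fold_slice_SUP)
  also have "\<dots> \<le> (SUP m. mixed_nn_norm q (F m))"
  proof (intro SUP_mono' mixed_nn_norm_mono_AE assms(1))
    show "AE x in lebesgue. G m x \<le> F m x" for m using GF by eventually_elim auto
  qed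
  finally show "mixed_nn_norm q (\<lambda>x. SUP m. F m x) \<le> (SUP m. mixed_nn_norm q (F m))" .
  show "(SUP m. mixed_nn_norm q (F m)) \<le> mixed_nn_norm q (\<lambda>x. SUP m. F m x)"
    using assms(1) by (intro SUP_least mixed_nn_norm_mono SUP_upper) auto
qed

lemma nn_integral_count_space_int_decode:
  "(\<integral>\<^sup>+j. f j \<partial>count_space (UNIV :: int set)) = (\<Sum>m. f (int_decode m))"
  using nn_integral_bij_count_space[OF bij_int_decode, of f] by (simp add: nn_integral_count_space_nat)

text \<open>Countable triangle inequality: \<open>int_decode\<close> enumerates the integers, the
  finite inequality bounds the partial sums, and monotone convergence passes to the limit. Sums over
  the integers are written as counting-measure integrals so that they can be exchanged with other
  integrals.\<close>

lemma mixed_nn_norm_count_space: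
  fixes F :: "int \<Rightarrow> real ^ 'n::{finite,linorder} \<Rightarrow> ennreal"
  assumes "\<And>i. 1 \<le> q $ i" "\<And>j. F j \<in> borel_measurable lebesgue"
  shows "mixed_nn_norm q (\<lambda>x. \<integral>\<^sup>+j. F j x \<partial>count_space UNIV)
       \<le> (\<integral>\<^sup>+j. mixed_nn_norm q (F j) \<partial>count_space UNIV)"
proof -
  have q: "0 < q $ i" for i using assms(1)[of i] by simp
  have "mixed_nn_norm q (\<lambda>x. \<integral>\<^sup>+j. F j x \<partial>count_space UNIV)
      = mixed_nn_norm q (\<lambda>x. SUP n. \<Sum>m<n. F (int_decode m) x)"
    by (simp add: nn_integral_count_space_int_decode suminf_eq_SUP)
  also have "\<dots> = (SUP n. mixed_nn_norm q (\<lambda>x. \<Sum>m<n. F (int_decode m) x))"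
    using assms(2) q
    by (intro mixed_nn_norm_SUP borel_measurable_sum)
       (auto simp: incseq_def le_fun_def intro!: sum_mono2)
  also have "\<dots> \<le> (SUP n. \<Sum>m<n. mixed_nn_norm q (F (int_decode m)))"
    using assms by (intro SUP_mono' mixed_nn_norm_sum) auto
  finally show ?thesis by (simp add: nn_integral_count_space_int_decode suminf_eq_SUP)
qed

section \<open>Mixed norms, integrals and dyadic balls\<close>

lemma slice_norm_one: "slice_norm 1 i F x = (\<integral>\<^sup>+t. F (\<chi> j. if j = i then t else x $ j) \<partial>lborel)"
  by (simp add: slice_norm_def)

text \<open>S holds the coordinates treated earlier in the iteration. A function that ignores them
  would have integral zero or infinity over them, so the indicator of {0..1}, of mass one, stands in
  for each. With S empty and all coordinates in the list this is Tonelli's theorem.\<close>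

lemma nn_integral_fold_slice_one:
  fixes F :: "real ^ 'n \<Rightarrow> ennreal"
  assumes "F \<in> borel_measurable borel" "distinct is" "S \<inter> set is = {}"
  shows "(\<integral>\<^sup>+x. (\<Prod>j\<in>S. indicator {0..1} (x $ j)) * F x \<partial>lborel)
       = (\<integral>\<^sup>+x. (\<Prod>j\<in>S \<union> set is. indicator {0..1} (x $ j)) * fold_slice 1 is F x \<partial>lborel)"
  using assms
proof (induction "is" arbitrary: S F)
  case (Cons i "is")
  note [measurable] = Cons.prems(1)
  have nth [measurable]: "(\<lambda>x::real ^ 'n. x $ j) \<in> borel_measurable borel" for j
    by (intro borel_measurable_continuous_onI continuous_intros)
  define P where "P = (\<lambda>x::real ^ 'n. \<Prod>j\<in>S. indicator {0..1} (x $ j) :: ennreal)"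
  have [measurable]: "P \<in> borel_measurable borel" unfolding P_def by measurable
  have i: "i \<notin> S" "finite S" using Cons.prems by auto
  have P: "P (\<chi> j. if j = i then t else x $ j) = P x" for x t
    unfolding P_def using i by (intro prod.cong) auto
  have "(\<integral>\<^sup>+x. P x * F x \<partial>lborel)
      = (\<integral>\<^sup>+x. indicator {0..1} (x $ i) * (\<integral>\<^sup>+t. P (\<chi> j. if j = i then t else x $ j)
          * F (\<chi> j. if j = i then t else x $ j) \<partial>lborel) \<partial>lborel)"
    by (subst nn_integral_slice[of "\<lambda>x. P x * F x"]) simp_all
  also have "\<dots> = (\<integral>\<^sup>+x. indicator {0..1} (x $ i) * (P x * slice_norm 1 i F x) \<partial>lborel)"
    unfolding P slice_norm_one by (simp add: nn_integral_cmult)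
  also have "\<dots> = (\<integral>\<^sup>+x. (\<Prod>j\<in>insert i S. indicator {0..1} (x $ j)) * slice_norm 1 i F x \<partial>lborel)"
    using i by (simp add: P_def mult.assoc)
  also have "\<dots> = (\<integral>\<^sup>+x. (\<Prod>j\<in>insert i S \<union> set is. indicator {0..1} (x $ j))
      * fold_slice 1 is (slice_norm 1 i F) x \<partial>lborel)"
    using Cons.prems by (intro Cons.IH borel_measurable_slice_norm) auto
  finally show ?case by (simp add: P_def)
qed simp

lemma nn_integral_unit_cube:
  "(\<integral>\<^sup>+x. (\<Prod>j\<in>UNIV. indicator {0..1} (x $ j)) \<partial>(lborel :: (real ^ 'n) measure)) = 1"
proof -
  have "(\<Prod>j\<in>UNIV. indicator {0..1} (x $ j) :: ennreal) = indicator (cbox 0 1) x" for x :: "real ^ 'n"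
    by (auto simp: indicator_def mem_box_cart prod_zero_iff)
  then have "(\<integral>\<^sup>+x. (\<Prod>j\<in>UNIV. indicator {0..1} (x $ j)) \<partial>(lborel :: (real ^ 'n) measure))
      = ennreal (\<Prod>b\<in>Basis. (1 :: real ^ 'n) \<bullet> b)"
    by (simp add: emeasure_lborel_cbox_eq Basis_vec_def inner_axis)
  also have "(\<Prod>b\<in>Basis. (1 :: real ^ 'n) \<bullet> b) = 1"
    by (intro prod.neutral) (auto simp: Basis_vec_def inner_axis)
  finally show ?thesis by simp
qed

text \<open>For the exponent vector 1 every stage is a plain integral; integrals are thus themselves
  mixed norms, and Hoelder's inequality can be proved one coordinate at a time.\<close>

lemma nn_integral_eq_mixed_nn_norm:
  fixes F :: "real ^ 'n::{finite,linorder} \<Rightarrow> ennreal"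
  assumes "F \<in> borel_measurable lebesgue"
  shows "(\<integral>\<^sup>+x. F x \<partial>lebesgue) = mixed_nn_norm 1 F"
proof -
  obtain F' where F': "F' \<in> borel_measurable borel" "AE x in lebesgue. F x = F' x"
    "mixed_nn_norm 1 F = mixed_nn_norm 1 F'"
    using lebesgue_borel_representative[of 1 F] assms by auto
  have nth [measurable]: "(\<lambda>x::real ^ 'n::{finite,linorder}. x $ j) \<in> borel_measurable borel" for j
    by (intro borel_measurable_continuous_onI continuous_intros)
  have "(\<integral>\<^sup>+x. F x \<partial>lebesgue) = (\<integral>\<^sup>+x. F' x \<partial>lborel)"
    using nn_integral_cong_AE[OF F'(2)] by (simp add: nn_integral_completion)
  also have "\<dots> = (\<integral>\<^sup>+x. (\<Prod>j\<in>UNIV. indicator {0..1} (x $ j)) * mixed_nn_norm 1 F'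
      \<partial>(lborel :: (real ^ 'n::{finite,linorder}) measure))"
    using nn_integral_fold_slice_one[OF F'(1) distinct_sorted_list_of_set Int_empty_left, of UNIV]
    by (simp only: fold_slice_eq_mixed_nn_norm set_sorted_list_of_set[OF finite] prod.empty mult_1_left Un_empty_left)
  also have "\<dots> = mixed_nn_norm 1 F'"
    by (simp add: nn_integral_multc nn_integral_unit_cube)
  finally show ?thesis using F'(3) by simp
qed

text \<open>
  Integrating \<open>h \<le> a + a\<^bsup>1-q\<^esup> h\<^bsup>q\<^esup>\<close> for the optimal \<open>a\<close> costs a factor 2 against the sharp Hoelder bound.
\<close>

lemma nn_integral_le_powr:
  fixes h :: "real \<Rightarrow> ennreal"
  assumes [measurable]: "h \<in> borel_measurable borel" and supp: "\<And>t. R < \<bar>t\<bar> \<Longrightarrow> h t = 0"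
    and q: "1 \<le> q" and R: "0 < R"
  shows "(\<integral>\<^sup>+t. h t \<partial>lborel) \<le> ennreal (4 * R powr (1 - 1 / q)) * ennpowr (\<integral>\<^sup>+t. ennpowr (h t) q \<partial>lborel) (1 / q)"
proof (cases "(\<integral>\<^sup>+t. ennpowr (h t) q \<partial>lborel)")
  case top
  then show ?thesis using R by (simp add: ennreal_mult_top)
next
  case (real v)
  show ?thesis
  proof (cases "v = 0")
    case True
    then have "AE t in lborel. ennpowr (h t) q = 0"
      using real nn_integral_0_iff_AE[of "\<lambda>t. ennpowr (h t) q" lborel] by simp
    then have "AE t in lborel. h t = 0"
      using q by (simp add: ennpowr_eq_0_iff)
    then have "(\<integral>\<^sup>+t. h t \<partial>lborel) = (\<integral>\<^sup>+t. 0 \<partial>(lborel :: real measure))"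
      by (intro nn_integral_cong_AE) auto
    then show ?thesis by simp
  next
    case False
    with real have v: "0 < v" by simp
    \<comment> \<open>This value makes \<open>a powr (1 - q) * v\<close> equal to 2 R a, so that the
      two terms balance and add up to 4 R a.\<close>
    define a where "a = (v / (2 * R)) powr (1 / q)"
    have a: "0 < a" using v R by (simp add: a_def)
    have aq: "a powr q = v / (2 * R)" using v R q by (simp add: a_def powr_powr)
    have pw: "h t \<le> ennreal a * indicator {-R..R} t + ennreal (a powr (1 - q)) * ennpowr (h t) q" for t
    proof (cases "h t")
      case top
      then show ?thesis using a by (simp add: ennreal_mult_top)
    next
      case (real s)
      show ?thesis
      proof (cases "R < \<bar>t\<bar>")
        case False
        have "s \<le> a + a powr (1 - q) * s powr q"
        proof (cases "s \<le> a")
          case False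
          then have s: "0 < s" "a \<le> s" using a by auto
          have "1 \<le> (s / a) powr (q - 1)" using s a q by (intro ge_one_powr_ge_zero) auto
          then have "s \<le> (s / a) powr (q - 1) * s" using s by (simp add: mult_le_cancel_right1)
          also have "\<dots> = (1 / a) powr (q - 1) * s powr q"
            using s a powr_add[of s "q - 1" 1] by (simp add: powr_divide)
          also have "(1 / a) powr (q - 1) = a powr (1 - q)"
            using a powr_minus[of a "q - 1"] by (simp add: powr_divide inverse_eq_divide)
          finally show ?thesis using a by simp
        next
          case True
          then show ?thesis by (simp add: add_increasing2)
        qed
        then show ?thesis
          using False real a by (simp add: indicator_def ennreal_mult[symmetric] ennreal_plus[symmetric] abs_le_iff not_less minus_le_iff del: ennreal_plus)
      qed (simp add: supp)
    qed
    have "(\<integral>\<^sup>+t. h t \<partial>lborel)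
        \<le> (\<integral>\<^sup>+t. ennreal a * indicator {-R..R} t + ennreal (a powr (1 - q)) * ennpowr (h t) q \<partial>lborel)"
      by (intro nn_integral_mono pw)
    also have "\<dots> = ennreal a * ennreal (2 * R) + ennreal (a powr (1 - q)) * ennreal v"
      using R real by (simp add: nn_integral_add nn_integral_cmult)
    also have "\<dots> = ennreal (a * (2 * R) + a powr (1 - q) * v)"
      using a R v by (simp add: ennreal_mult)
    also have "a powr (1 - q) * v = a * (2 * R)"
    proof -
      have "v = a powr q * (2 * R)" using aq R by simp
      then show ?thesis using a powr_add[of a "1 - q" q] by simp
    qed
    also have "a * (2 * R) + a * (2 * R) = 4 * R powr 1 * (v powr (1 / q) / (2 * R) powr (1 / q))"
      using R v by (simp add: a_def powr_divide)
    also have "\<dots> \<le> 4 * R powr 1 * (v powr (1 / q) / R powr (1 / q))"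
      using R v q by (intro mult_left_mono divide_left_mono powr_mono2) auto
    also have "\<dots> = 4 * R powr (1 - 1 / q) * v powr (1 / q)"
      using R by (simp add: powr_diff)
    finally show ?thesis
      using real R v by (simp add: ennreal_mult[symmetric] ennreal_leI)
  qed
qed

text \<open>One-variable Hoelder at each stage, the factors being collected in c. Slicing in one
  coordinate keeps the vanishing in the coordinates still to come, since the list is
  distinct.\<close>

lemma fold_slice_one_le:
  fixes F G :: "real ^ 'n \<Rightarrow> ennreal"
  assumes q: "\<And>i. 1 \<le> q $ i" and R: "0 < R" and "distinct is"
    and "G \<in> borel_measurable borel" "\<And>x i. i \<in> set is \<Longrightarrow> R < \<bar>x $ i\<bar> \<Longrightarrow> G x = 0"
    and "\<And>x. F x \<le> c * G x"
  shows "fold_slice 1 is F x \<le> c * (\<Prod>i\<in>set is. ennreal (4 * R powr (1 - 1 / q $ i))) * fold_slice q is G x"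
  using assms(3-)
proof (induction "is" arbitrary: F G c)
  case (Cons i "is")
  note [measurable] = Cons.prems(2)
  let ?k = "ennreal (4 * R powr (1 - 1 / q $ i))"
  have "slice_norm 1 i F x \<le> c * ?k * slice_norm (q $ i) i G x" for x
  proof -
    have "slice_norm 1 i F x \<le> (\<integral>\<^sup>+t. c * G (\<chi> j. if j = i then t else x $ j) \<partial>lborel)"
      unfolding slice_norm_one by (intro nn_integral_mono Cons.prems)
    also have "\<dots> = c * (\<integral>\<^sup>+t. G (\<chi> j. if j = i then t else x $ j) \<partial>lborel)"
      by (simp add: nn_integral_cmult)
    also have "\<dots> \<le> c * (?k * slice_norm (q $ i) i G x)"
      unfolding slice_norm_def using q R Cons.prems(3)[of i]
      by (intro mult_left_mono nn_integral_le_powr) auto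
    finally show ?thesis by (simp add: mult.assoc)
  qed
  moreover have "slice_norm (q $ i) i G x = 0" if "j \<in> set is" "R < \<bar>x $ j\<bar>" for j x
  proof -
    have "G (\<chi> j. if j = i then t else x $ j) = 0" for t
      using that Cons.prems(1) by (intro Cons.prems(3)[of j]) auto
    then show ?thesis by (simp add: slice_norm_def)
  qed
  ultimately have "fold_slice 1 is (slice_norm 1 i F) x
      \<le> c * ?k * (\<Prod>i\<in>set is. ennreal (4 * R powr (1 - 1 / q $ i))) * fold_slice q is (slice_norm (q $ i) i G) x"
    using Cons.prems by (intro Cons.IH) (auto simp: borel_measurable_slice_norm)
  then show ?case using Cons.prems(1) by (simp add: mult.assoc)
qed simp

text \<open>The indicator of a cube is a product, so each stage integrates out one factor and leaves
  the others untouched. The bound (2R)^(1/q) \<le> 2 R^(1/q) frees the constant from the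
  exponent.\<close>

lemma fold_slice_indicator_le:
  fixes F :: "real ^ 'n \<Rightarrow> ennreal"
  assumes q: "\<And>i. 1 \<le> q $ i" and R: "0 < R" and "distinct is"
    and "\<And>x. F x \<le> c * (\<Prod>i\<in>set is. indicator {-R..R} (x $ i))"
  shows "fold_slice q is F x \<le> c * (\<Prod>i\<in>set is. ennreal (2 * R powr (1 / q $ i)))"
  using assms(3-)
proof (induction "is" arbitrary: F c)
  case (Cons i "is")
  let ?k = "ennreal (2 * R powr (1 / q $ i))"
  let ?P = "\<lambda>x. \<Prod>i\<in>set is. indicator {-R..R} (x $ i) :: ennreal"
  have q0: "0 < q $ i" using q[of i] by simp
  have ind: "ennpowr (indicator A t) a = indicator A t" for A and t a :: real
    by (simp add: indicator_def)
  have "slice_norm (q $ i) i F x \<le> c * ?k * ?P x" for x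
  proof -
    have P: "?P (\<chi> j. if j = i then t else x $ j) = ?P x" for t
      using Cons.prems(1) by (intro prod.cong) auto
    have "F (\<chi> j. if j = i then t else x $ j) \<le> c * ?P x * indicator {-R..R} t" for t
      using Cons.prems(2)[of "\<chi> j. if j = i then t else x $ j"] Cons.prems(1)
      by (simp add: P[of t, simplified] mult.assoc mult.commute[of "indicator _ _"])
    then have "slice_norm (q $ i) i F x
        \<le> ennpowr (\<integral>\<^sup>+t. ennpowr (c * ?P x * indicator {-R..R} t) (q $ i) \<partial>lborel) (1 / q $ i)"
      unfolding slice_norm_def using q0 by (intro ennpowr_mono nn_integral_mono) auto
    also have "\<dots> = c * ?P x * ennreal ((2 * R) powr (1 / q $ i))"
      using q0 R by (simp add: ennpowr_mult ind nn_integral_cmult ennpowr_ennpowr)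
    also have "\<dots> \<le> c * ?P x * ?k"
    proof (intro mult_left_mono ennreal_leI)
      have "2 powr (1 / q $ i) \<le> 2 powr (1 :: real)" using q[of i] by (intro powr_mono) auto
      then show "(2 * R) powr (1 / q $ i) \<le> 2 * R powr (1 / q $ i)"
        using R by (simp add: powr_mult mult_right_mono)
    qed simp
    finally show ?thesis by (simp only: mult.assoc mult.commute[of ?k])
  qed
  then have "fold_slice q is (slice_norm (q $ i) i F) x \<le> c * ?k * (\<Prod>i\<in>set is. ennreal (2 * R powr (1 / q $ i)))"
    using Cons.prems(1) by (intro Cons.IH) auto
  then show ?case using Cons.prems(1) by (simp add: mult.assoc)
qed simp

section \<open>Hoelder's inequality and norms of indicators on dyadic balls\<close>

lemma dyadic_ball_bound: "x \<in> dyadic_ball k \<Longrightarrow> \<bar>x $ i\<bar> \<le> 2 powr real_of_int k"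
  using component_le_norm_cart[of x i] by (simp add: dyadic_ball_def powr_real_of_int')

lemma nn_integral_dyadic_ball_le:
  fixes F :: "real ^ 'n::{finite,linorder} \<Rightarrow> ennreal"
  assumes q: "\<And>i. 1 \<le> q $ i" and "F \<in> borel_measurable lebesgue" and "\<And>x. x \<notin> dyadic_ball k \<Longrightarrow> F x = 0"
  shows "(\<integral>\<^sup>+x. F x \<partial>lebesgue)
       \<le> ennreal (4 ^ CARD('n) * 2 powr (k * (CARD('n) - (\<Sum>i\<in>UNIV. 1 / q $ i)))) * mixed_nn_norm q F"
proof -
  have q0: "0 < q $ i" for i using q[of i] by simp
  define Q where "Q = {x::real ^ 'n::{finite,linorder}. \<forall>i. \<bar>x $ i\<bar> \<le> 2 powr real_of_int k}"
  have Q [measurable]: "Q \<in> sets borel"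
    unfolding Q_def by (intro borel_closed closed_Collect_all closed_Collect_le continuous_intros)
  obtain F' where F': "F' \<in> borel_measurable borel" "AE x in lebesgue. F x = F' x"
    "mixed_nn_norm q F = mixed_nn_norm q F'"
    using lebesgue_borel_representative[of q F] assms q0 by blast
  note [measurable] = F'(1)
  \<comment> \<open>A Borel representative may be nonzero outside the ball on a null set, but
    \<open>fold_slice_one_le\<close> asks for vanishing everywhere; cutting off with the enclosing
    cube restores this without changing the norm.\<close>
  define G where "G = (\<lambda>x. F' x * indicator Q x)"
  have G [measurable]: "G \<in> borel_measurable borel" unfolding G_def by measurable
  have FG: "AE x in lebesgue. F x = G x"
    using F'(2)
  proof eventually_elim
    case (elim x)
    then show ?case using assms(3)[of x] dyadic_ball_bound[of x k] by (auto simp: G_def Q_def indicator_def)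
  qed
  have norm: "mixed_nn_norm q G = mixed_nn_norm q F"
    using FG q0 by (intro antisym mixed_nn_norm_mono_AE) auto
  have "(\<integral>\<^sup>+x. F x \<partial>lebesgue) = (\<integral>\<^sup>+x. G x \<partial>lebesgue)"
    using FG by (rule nn_integral_cong_AE)
  also have "\<dots> = mixed_nn_norm 1 G"
    by (rule nn_integral_eq_mixed_nn_norm) (simp add: measurable_completion)
  also have "\<dots> \<le> 1 * (\<Prod>i\<in>set (sorted_list_of_set UNIV).
      ennreal (4 * (2 powr real_of_int k) powr (1 - 1 / q $ i))) * fold_slice q (sorted_list_of_set UNIV) G 0"
    unfolding mixed_nn_norm_def
    by (rule fold_slice_one_le) (use q in \<open>auto simp: G_def Q_def indicator_def not_le[symmetric]\<close>)
  also have "(\<Prod>i\<in>set (sorted_list_of_set UNIV). ennreal (4 * (2 powr real_of_int k) powr (1 - 1 / q $ i)))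
      = ennreal (\<Prod>i\<in>UNIV. 4 * (2 powr real_of_int k) powr (1 - 1 / q $ i))"
    by (simp add: prod_ennreal)
  also have "(\<Prod>i\<in>UNIV. 4 * (2 powr real_of_int k) powr (1 - 1 / q $ i))
      = 4 ^ CARD('n) * 2 powr (k * (CARD('n) - (\<Sum>i\<in>UNIV. 1 / q $ i)))"
    by (simp add: prod.distrib powr_powr sum_subtractf right_diff_distrib sum_distrib_left mult.commute flip: powr_sum)
  finally show ?thesis by (simp add: norm mixed_nn_norm_def[symmetric])
qed

lemma mixed_nn_norm_indicator_dyadic_ball:
  fixes q :: "real ^ 'n::{finite,linorder}"
  assumes q: "\<And>i. 1 \<le> q $ i"
  shows "mixed_nn_norm q (indicator (dyadic_ball k)) \<le> ennreal (2 ^ CARD('n) * 2 powr (k * (\<Sum>i\<in>UNIV. 1 / q $ i)))"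
proof -
  have "mixed_nn_norm q (indicator (dyadic_ball k))
      \<le> 1 * (\<Prod>i\<in>set (sorted_list_of_set UNIV). ennreal (2 * (2 powr real_of_int k) powr (1 / q $ i)))"
    unfolding mixed_nn_norm_def
  proof (rule fold_slice_indicator_le)
    fix x :: "real ^ 'n::{finite,linorder}"
    show "indicator (dyadic_ball k) x
      \<le> 1 * (\<Prod>i\<in>set (sorted_list_of_set UNIV). indicator {- (2 powr real_of_int k)..2 powr real_of_int k} (x $ i) :: ennreal)"
      using dyadic_ball_bound[of x k] by (auto simp: indicator_def abs_le_iff minus_le_iff prod.neutral)
  qed (use q in auto)
  also have "\<dots> = ennreal (\<Prod>i\<in>UNIV. 2 * (2 powr real_of_int k) powr (1 / q $ i))"
    by (simp add: prod_ennreal)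
  also have "(\<Prod>i\<in>UNIV. 2 * (2 powr real_of_int k) powr (1 / q $ i)) = 2 ^ CARD('n) * 2 powr (k * (\<Sum>i\<in>UNIV. 1 / q $ i))"
    by (simp add: prod.distrib powr_powr sum_distrib_left flip: powr_sum)
  finally show ?thesis .
qed

section \<open>The fractional maximal commutator on dyadic shells\<close>

text \<open>As b is only Lebesgue measurable, Tonelli's theorem for the kernel |b x - b y| is
  applied to Lebesgue measure itself.\<close>

lemma sigma_finite_lebesgue: "sigma_finite_measure (lebesgue :: 'a::euclidean_space measure)"
proof
  have "\<exists>A. countable A \<and> A \<subseteq> sets (lborel :: 'a measure) \<and> \<Union>A = space lborel
      \<and> (\<forall>a\<in>A. emeasure lborel a \<noteq> \<infinity>)"
    by (rule lborel.sigma_finite_countable)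
  then obtain A :: "'a set set" where A: "countable A" "A \<subseteq> sets lborel" "\<Union>A = space lborel"
    "\<forall>a\<in>A. emeasure lborel a \<noteq> \<infinity>"
    by blast
  then have "\<forall>a\<in>A. emeasure lebesgue a \<noteq> \<infinity>" by auto
  with A show "\<exists>A. countable A \<and> A \<subseteq> sets (lebesgue :: 'a measure) \<and> \<Union>A = space lebesgue
      \<and> (\<forall>a\<in>A. emeasure lebesgue a \<noteq> \<infinity>)"
    by (intro exI[of _ A]) auto
qed

definition comm_integral :: "(real ^ 'n \<Rightarrow> real) \<Rightarrow> (real ^ 'n \<Rightarrow> ennreal) \<Rightarrow> real ^ 'n \<Rightarrow> ennreal" where
  "comm_integral b g x = (\<integral>\<^sup>+y. ennreal \<bar>b x - b y\<bar> * g y \<partial>lebesgue)"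

text \<open>The restriction to the ball is moved onto g, so that the maximal function is a supremum
  of multiples of \<open>comm_integral\<close> applied to truncations of g.\<close>

definition max_comm :: "real \<Rightarrow> (real ^ 'n \<Rightarrow> real) \<Rightarrow> (real ^ 'n \<Rightarrow> ennreal) \<Rightarrow> real ^ 'n \<Rightarrow> ennreal" where
  "max_comm l b g x = (SUP r\<in>{0<..}. ennreal (measure lebesgue (cball x r) powr (- (1 - 1 / l))) *
     comm_integral b (\<lambda>y. g y * indicator (cball x r) y) x)"

lemma frac_max_comm_eq: "frac_max_comm l b f x = enn2ereal (max_comm l b (\<lambda>y. e2ennreal \<bar>f y\<bar>) x)"
  by (simp add: frac_max_comm_def max_comm_def comm_integral_def mult.assoc)

lemma borel_measurable_comm_integral [measurable]:
  assumes [measurable]: "b \<in> borel_measurable lebesgue" "g \<in> borel_measurable lebesgue"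
  shows "comm_integral b g \<in> borel_measurable lebesgue"
proof -
  interpret sigma_finite_measure "lebesgue :: (real ^ 'a) measure" by (rule sigma_finite_lebesgue)
  show ?thesis unfolding comm_integral_def[abs_def] by measurable
qed

lemma comm_integral_mono: "(\<And>y. g y \<le> h y) \<Longrightarrow> comm_integral b g x \<le> comm_integral b h x"
  unfolding comm_integral_def by (intro nn_integral_mono mult_left_mono) auto

lemma nn_integral_comm_integral_commute:
  assumes [measurable]: "b \<in> borel_measurable lebesgue" "g \<in> borel_measurable lebesgue" "h \<in> borel_measurable lebesgue"
  shows "(\<integral>\<^sup>+x. h x * comm_integral b g x \<partial>lebesgue) = (\<integral>\<^sup>+x. g x * comm_integral b h x \<partial>lebesgue)"
proof -
  interpret sigma_finite_measure "lebesgue :: (real ^ 'a) measure" by (rule sigma_finite_lebesgue)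
  interpret L: pair_sigma_finite "lebesgue :: (real ^ 'a) measure" "lebesgue :: (real ^ 'a) measure" ..
  have "(\<integral>\<^sup>+x. h x * comm_integral b g x \<partial>lebesgue)
      = (\<integral>\<^sup>+x. \<integral>\<^sup>+y. h x * (ennreal \<bar>b x - b y\<bar> * g y) \<partial>lebesgue \<partial>lebesgue)"
    by (simp add: comm_integral_def nn_integral_cmult)
  also have "\<dots> = (\<integral>\<^sup>+y. \<integral>\<^sup>+x. h x * (ennreal \<bar>b x - b y\<bar> * g y) \<partial>lebesgue \<partial>lebesgue)"
    by (rule L.Fubini'[symmetric]) measurable
  also have "\<dots> = (\<integral>\<^sup>+y. \<integral>\<^sup>+x. g y * (ennreal \<bar>b y - b x\<bar> * h x) \<partial>lebesgue \<partial>lebesgue)"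
    by (simp add: abs_minus_commute mult_ac)
  finally show ?thesis by (simp add: comm_integral_def nn_integral_cmult)
qed

text \<open>The triangle inequality for b through an intermediate point z, integrated with weight h
  in z. It is left multiplied by the mass of h, so that no division by zero or infinity arises;
  later h is the indicator of a ball.\<close>

lemma comm_integral_triangle:
  assumes [measurable]: "b \<in> borel_measurable lebesgue" "g \<in> borel_measurable lebesgue" "h \<in> borel_measurable lebesgue"
  shows "(\<integral>\<^sup>+z. h z \<partial>lebesgue) * comm_integral b g x
       \<le> (\<integral>\<^sup>+y. g y \<partial>lebesgue) * comm_integral b h x + (\<integral>\<^sup>+z. h z * comm_integral b g z \<partial>lebesgue)"
proof -
  interpret sigma_finite_measure "lebesgue :: (real ^ 'a) measure" by (rule sigma_finite_lebesgue)
  have "(\<integral>\<^sup>+z. h z \<partial>lebesgue) * comm_integral b g x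
      = (\<integral>\<^sup>+z. \<integral>\<^sup>+y. h z * (ennreal \<bar>b x - b y\<bar> * g y) \<partial>lebesgue \<partial>lebesgue)"
    by (simp add: comm_integral_def nn_integral_cmult nn_integral_multc)
  also have "\<dots> \<le> (\<integral>\<^sup>+z. \<integral>\<^sup>+y. ennreal \<bar>b x - b z\<bar> * h z * g y + h z * (ennreal \<bar>b z - b y\<bar> * g y) \<partial>lebesgue \<partial>lebesgue)"
  proof (intro nn_integral_mono)
    fix z y
    have "ennreal \<bar>b x - b y\<bar> \<le> ennreal \<bar>b x - b z\<bar> + ennreal \<bar>b z - b y\<bar>"
      by (subst ennreal_plus[symmetric]) (simp_all add: ennreal_leI del: ennreal_plus)
    then have "h z * g y * ennreal \<bar>b x - b y\<bar> \<le> h z * g y * (ennreal \<bar>b x - b z\<bar> + ennreal \<bar>b z - b y\<bar>)"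
      by (rule mult_left_mono) simp
    then show "h z * (ennreal \<bar>b x - b y\<bar> * g y)
        \<le> ennreal \<bar>b x - b z\<bar> * h z * g y + h z * (ennreal \<bar>b z - b y\<bar> * g y)"
      by (simp add: distrib_left mult_ac)
  qed
  also have "\<dots> = (\<integral>\<^sup>+z. ennreal \<bar>b x - b z\<bar> * h z * (\<integral>\<^sup>+y. g y \<partial>lebesgue) + h z * comm_integral b g z \<partial>lebesgue)"
    by (simp add: comm_integral_def nn_integral_add nn_integral_cmult)
  also have "\<dots> = (\<integral>\<^sup>+y. g y \<partial>lebesgue) * comm_integral b h x + (\<integral>\<^sup>+z. h z * comm_integral b g z \<partial>lebesgue)"
    by (simp add: nn_integral_add nn_integral_multc comm_integral_def[symmetric] mult.commute[of "integral\<^sup>N lebesgue g"])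
  finally show ?thesis .
qed

text \<open>The previous inequality integrated against g. For indicators of balls it inserts an
  intermediate ball, the one given by u, between those given by g and h.\<close>

lemma nn_integral_comm_integral_triangle:
  assumes [measurable]: "b \<in> borel_measurable lebesgue" "g \<in> borel_measurable lebesgue"
    "h \<in> borel_measurable lebesgue" "u \<in> borel_measurable lebesgue"
  shows "(\<integral>\<^sup>+z. u z \<partial>lebesgue) * (\<integral>\<^sup>+x. g x * comm_integral b h x \<partial>lebesgue)
       \<le> (\<integral>\<^sup>+y. g y \<partial>lebesgue) * (\<integral>\<^sup>+x. u x * comm_integral b h x \<partial>lebesgue)
         + (\<integral>\<^sup>+y. h y \<partial>lebesgue) * (\<integral>\<^sup>+x. g x * comm_integral b u x \<partial>lebesgue)"
proof -
  have "(\<integral>\<^sup>+z. u z \<partial>lebesgue) * (\<integral>\<^sup>+x. g x * comm_integral b h x \<partial>lebesgue)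
      = (\<integral>\<^sup>+x. g x * ((\<integral>\<^sup>+z. u z \<partial>lebesgue) * comm_integral b h x) \<partial>lebesgue)"
    by (simp add: nn_integral_cmult[symmetric] mult_ac)
  also have "\<dots> \<le> (\<integral>\<^sup>+x. g x * ((\<integral>\<^sup>+y. h y \<partial>lebesgue) * comm_integral b u x
      + (\<integral>\<^sup>+z. u z * comm_integral b h z \<partial>lebesgue)) \<partial>lebesgue)"
    by (intro nn_integral_mono mult_left_mono comm_integral_triangle) auto
  also have "\<dots> = (\<integral>\<^sup>+x. (\<integral>\<^sup>+y. h y \<partial>lebesgue) * (g x * comm_integral b u x)
      + (\<integral>\<^sup>+z. u z * comm_integral b h z \<partial>lebesgue) * g x \<partial>lebesgue)"
    by (simp add: distrib_left mult_ac)
  also have "\<dots> = (\<integral>\<^sup>+y. h y \<partial>lebesgue) * (\<integral>\<^sup>+x. g x * comm_integral b u x \<partial>lebesgue)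
      + (\<integral>\<^sup>+z. u z * comm_integral b h z \<partial>lebesgue) * (\<integral>\<^sup>+x. g x \<partial>lebesgue)"
    by (subst nn_integral_add) (simp_all add: nn_integral_cmult)
  finally show ?thesis by (simp add: add.commute mult.commute)
qed

section \<open>Dyadic powers, shells and the sizes of balls\<close>

abbreviation pw :: "real \<Rightarrow> ennreal" where "pw a \<equiv> ennreal (2 powr a)"

lemma pw_mult: "pw a * pw b = pw (a + b)"
  by (simp add: powr_add ennreal_mult)

lemma pw_mult_left: "pw a * (pw b * z) = pw (a + b) * z"
  by (simp add: pw_mult mult.assoc[symmetric])

lemma pw_pos [simp]: "pw a \<noteq> 0"
  by (simp add: ennreal_eq_0_iff not_le)

lemma sets_dyadic [measurable]:
  "(dyadic_ball k :: (real ^ 'n) set) \<in> sets lebesgue" "(dyadic_shell k :: (real ^ 'n) set) \<in> sets lebesgue"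
proof -
  have "dyadic_ball k = cball (0 :: real ^ 'n) (2 powi k)" for k
    by (auto simp: dyadic_ball_def)
  then have *: "(dyadic_ball k :: (real ^ 'n) set) \<in> sets lebesgue" for k
    by simp
  from *[of k] show "(dyadic_ball k :: (real ^ 'n) set) \<in> sets lebesgue" .
  show "(dyadic_shell k :: (real ^ 'n) set) \<in> sets lebesgue"
    unfolding dyadic_shell_def by (intro sets.Diff *)
qed

lemma dyadic_ball_mono: "j \<le> k \<Longrightarrow> dyadic_ball j \<subseteq> dyadic_ball k"
  unfolding dyadic_ball_def by (auto intro!: order_trans[OF _ power_int_increasing[of j k 2]])

lemma mem_dyadic_ball: "x \<in> dyadic_ball k \<longleftrightarrow> norm x \<le> 2 powr k"
  by (simp add: dyadic_ball_def powr_real_of_int')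

lemma mem_dyadic_shell: "x \<in> dyadic_shell k \<longleftrightarrow> 2 powr (k - 1) < norm x \<and> norm x \<le> 2 powr k"
  by (auto simp: dyadic_shell_def mem_dyadic_ball)

text \<open>The hypothesis restated for nonnegative functions. Membership of the image in the target
  space supplies the measurability of the maximal function; it is an assumption of its own because
  the triangle inequality for norms of sums relies on it.\<close>

locale bounded_max_comm =
  fixes l D :: real and b :: "real ^ 'n::{finite,linorder} \<Rightarrow> real" and q1 q2 :: "real ^ 'n::{finite,linorder}"
  assumes l: "1 < l" and q1: "\<And>i. 1 \<le> q1 $ i" and q2: "\<And>i. 1 \<le> q2 $ i"
    and b [measurable]: "b \<in> borel_measurable lebesgue"
    and exponents: "real CARD('n) / l = (\<Sum>i\<in>UNIV. 1 / q1 $ i) - (\<Sum>i\<in>UNIV. 1 / q2 $ i)"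
    and measurable_max_comm: "\<And>g. g \<in> borel_measurable lebesgue \<Longrightarrow> mixed_nn_norm q1 g < top \<Longrightarrow>
      max_comm l b g \<in> borel_measurable lebesgue"
    and max_comm_bound: "\<And>g. g \<in> borel_measurable lebesgue \<Longrightarrow> mixed_nn_norm q1 g < top \<Longrightarrow>
      mixed_nn_norm q2 (max_comm l b g) \<le> ennreal D * mixed_nn_norm q1 g"
begin

definition "N = real CARD('n)"
definition "s1 = (\<Sum>i\<in>UNIV. 1 / q1 $ i)"
definition "s2 = (\<Sum>i\<in>UNIV. 1 / q2 $ i)"
text \<open>By \<open>\<tau>_eq\<close> this is N/l', so 2^(k \<tau>) is comparable to |B_k|^(1/l'),
  the normalisation of the maximal function at radius 2^k.\<close>

definition "\<tau> = N - s1 + s2"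
definition "\<theta> = 1 - 1 / l"
definition "V = measure lebesgue (cball (0 :: real ^ 'n::{finite,linorder}) 1)"

abbreviation "T \<equiv> comm_integral b"
abbreviation "M \<equiv> max_comm l b"
abbreviation "B \<equiv> \<lambda>k::int. indicator (dyadic_ball k) :: real ^ 'n::{finite,linorder} \<Rightarrow> ennreal"

lemma \<theta>_pos: "0 < \<theta>" using l by (simp add: \<theta>_def)

lemma \<tau>_eq: "\<tau> = N * \<theta>"
  using exponents by (simp add: \<tau>_def \<theta>_def N_def s1_def s2_def right_diff_distrib)

lemma V_pos: "0 < V"
  unfolding V_def using content_cball_pos[of 1 "0 :: real ^ 'n::{finite,linorder}"] by (simp add: measure_completion)

lemma q_pos: "0 < q1 $ i" "0 < q2 $ i"
  using q1[of i] q2[of i] by simp_all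

lemma measure_cball: "0 < r \<Longrightarrow> measure lebesgue (cball (x :: real ^ 'n::{finite,linorder}) r) = V * r powr N"
  using content_ball_conv_unit_ball[of r x] content_ball_conv_unit_ball[of 1 "0 :: real ^ 'n::{finite,linorder}"]
  by (simp add: V_def N_def content_cball_conv_ball powr_realpow)

lemma nn_integral_B: "(\<integral>\<^sup>+x. B k x \<partial>lebesgue) = ennreal V * pw (k * N)"
proof -
  have "dyadic_ball k = cball (0 :: real ^ 'n::{finite,linorder}) (2 powr k)"
    by (auto simp: mem_dyadic_ball)
  moreover have "emeasure lebesgue (cball (0 :: real ^ 'n::{finite,linorder}) (2 powr k))
      = ennreal (measure lebesgue (cball (0 :: real ^ 'n::{finite,linorder}) (2 powr k)))"
    using emeasure_lborel_cball_finite[of "0 :: real ^ 'n::{finite,linorder}" "2 powr k"]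
    by (intro emeasure_eq_ennreal_measure) auto
  moreover have "measure lebesgue (cball (0 :: real ^ 'n::{finite,linorder}) (2 powr k)) = V * (2 powr k) powr N"
    by (rule measure_cball) simp
  ultimately show ?thesis
    using V_pos by (simp only: nn_integral_indicator[OF sets_dyadic(1)]) (simp add: powr_powr ennreal_mult)
qed

lemma coefficient_eq: "(V * (2 powr t) powr N) powr (- \<theta>) = V powr (- \<theta>) * 2 powr (- t * \<tau>)"
  using V_pos by (simp add: powr_mult powr_powr \<tau>_eq mult.assoc)

text \<open>The single radius 2^(k+1) suffices: the ball about x then contains B_k and hence the
  support of g.\<close>

lemma comm_integral_le_max_comm:
  assumes x: "x \<in> dyadic_ball k" and g: "\<And>y. y \<notin> dyadic_ball k \<Longrightarrow> g y = 0"
  shows "T g x \<le> ennreal (V powr \<theta>) * pw \<tau> * pw (k * \<tau>) * M g x"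
proof -
  define r where "r = 2 powr (real_of_int k + 1)"
  have "0 < r" by (simp add: r_def)
  have "g y * indicator (cball x r) y = g y" for y
  proof (cases "y \<in> dyadic_ball k")
    case True
    then have "dist x y \<le> r"
      using x norm_triangle_ineq4[of x y] by (simp add: mem_dyadic_ball dist_norm r_def powr_add)
    then show ?thesis by simp
  qed (simp add: g)
  then have "ennreal (measure lebesgue (cball x r) powr (- (1 - 1 / l))) * T g x \<le> M g x"
    unfolding max_comm_def by (intro SUP_upper2[of r]) (simp_all add: r_def)
  also have "measure lebesgue (cball x r) powr (- (1 - 1 / l)) = V powr (- \<theta>) * 2 powr (- (real_of_int k + 1) * \<tau>)"
    unfolding measure_cball[OF \<open>0 < r\<close>] unfolding \<theta>_def[symmetric] r_def by (rule coefficient_eq)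
  finally have "ennreal (V powr \<theta>) * pw \<tau> * pw (k * \<tau>) * (ennreal (V powr (- \<theta>) * 2 powr (- (real_of_int k + 1) * \<tau>)) * T g x)
      \<le> ennreal (V powr \<theta>) * pw \<tau> * pw (k * \<tau>) * M g x"
    by (rule mult_left_mono) simp
  also have "ennreal (V powr \<theta>) * pw \<tau> * pw (k * \<tau>) * (ennreal (V powr (- \<theta>) * 2 powr (- (real_of_int k + 1) * \<tau>)) * T g x)
     = ennreal (V powr \<theta> * V powr (- \<theta>) * (2 powr \<tau> * 2 powr (k * \<tau>) * 2 powr (- (real_of_int k + 1) * \<tau>))) * T g x"
    by (simp add: ennreal_mult mult_ac)
  also have "V powr \<theta> * V powr (- \<theta>) * (2 powr \<tau> * 2 powr (k * \<tau>) * 2 powr (- (real_of_int k + 1) * \<tau>)) = 1"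
    using V_pos by (simp add: powr_add[symmetric] algebra_simps)
  finally show ?thesis by simp
qed

text \<open>A ball about x \<in> A_k that meets A_j has radius at least 2^(max j k - 2), because the
  larger of the two norms exceeds 2^(max j k - 1) and the smaller is at most 2^(max j k - 2). Balls
  missing A_j contribute nothing, and the coefficient decreases with the radius.\<close>

lemma max_comm_le_comm_integral:
  assumes x: "x \<in> dyadic_shell k" and g: "\<And>y. y \<notin> dyadic_shell j \<Longrightarrow> g y = 0" and jk: "2 \<le> \<bar>j - k\<bar>"
  shows "M g x \<le> ennreal (V powr (- \<theta>)) * pw (2 * \<tau>) * pw (- real_of_int (max j k) * \<tau>) * T g x"
  unfolding max_comm_def
proof (rule SUP_least)
  fix r :: real assume r: "r \<in> {0<..}"
  define m where "m = max j k"
  show "ennreal (measure lebesgue (cball x r) powr (- (1 - 1 / l))) * T (\<lambda>y. g y * indicator (cball x r) y) x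
    \<le> ennreal (V powr (- \<theta>)) * pw (2 * \<tau>) * pw (- real_of_int (max j k) * \<tau>) * T g x"
  proof (cases "\<exists>y. y \<in> cball x r \<and> y \<in> dyadic_shell j")
    case False
    then have "(\<lambda>y. g y * indicator (cball x r) y) = (\<lambda>y. 0)"
      using g by (auto simp: indicator_def fun_eq_iff)
    then show ?thesis by (simp add: comm_integral_def)
  next
    case True
    then obtain y where y: "dist x y \<le> r" "y \<in> dyadic_shell j" by auto
    have four: "2 powr (a - 2) = 2 powr a / (4 :: real)" for a by (simp add: powr_diff)
    have two: "2 powr (a - 1) = 2 powr a / (2 :: real)" for a by (simp add: powr_diff)
    have "2 powr (real_of_int m - 2) \<le> r"
    proof (cases "j \<le> k")
      case True
      then have "real_of_int j \<le> real_of_int k - 2" using jk by linarith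
      then have "(2::real) powr j \<le> 2 powr (real_of_int k - 2)" by simp
      then show ?thesis
        using True x y norm_triangle_ineq2[of x y]
        unfolding mem_dyadic_shell m_def max.absorb2[OF True] dist_norm four two by linarith
    next
      case False
      then have "real_of_int k \<le> real_of_int j - 2" "k \<le> j" using jk by linarith+
      then have "(2::real) powr k \<le> 2 powr (real_of_int j - 2)" by simp
      then show ?thesis
        using x y norm_triangle_ineq2[of y x] \<open>k \<le> j\<close>
        unfolding mem_dyadic_shell m_def max.absorb1[OF \<open>k \<le> j\<close>] dist_norm norm_minus_commute[of x y] four two
        by linarith
    qed
    then have "V * (2 powr (real_of_int m - 2)) powr N \<le> V * r powr N"
      using V_pos by (intro mult_left_mono powr_mono2) (auto simp: N_def)
    then have "measure lebesgue (cball x r) powr (- \<theta>) \<le> (V * (2 powr (real_of_int m - 2)) powr N) powr (- \<theta>)"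
      using r V_pos \<theta>_pos unfolding measure_cball[OF r[unfolded greaterThan_iff]]
      by (intro powr_mono2') auto
    also have "\<dots> = V powr (- \<theta>) * (2 powr (2 * \<tau>) * 2 powr (- real_of_int m * \<tau>))"
      unfolding coefficient_eq by (simp add: powr_add[symmetric] algebra_simps)
    finally have "ennreal (measure lebesgue (cball x r) powr (- \<theta>)) \<le> ennreal (V powr (- \<theta>)) * pw (2 * \<tau>) * pw (- real_of_int m * \<tau>)"
      by (simp add: ennreal_mult[symmetric] ennreal_leI mult.assoc)
    then show ?thesis
      unfolding m_def \<theta>_def[symmetric]
      by (intro mult_mono comm_integral_mono) (auto simp: indicator_def)
  qed
qed

end

section \<open>Oscillation of b in the two mixed norms\<close>

context bounded_max_comm
begin

lemma norm_B: "mixed_nn_norm q1 (B k) \<le> ennreal (2 ^ CARD('n)) * pw (k * s1)"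
  "mixed_nn_norm q2 (B k) \<le> ennreal (2 ^ CARD('n)) * pw (k * s2)"
  using mixed_nn_norm_indicator_dyadic_ball[OF q1, of k] mixed_nn_norm_indicator_dyadic_ball[OF q2, of k]
  by (simp_all add: ennreal_mult s1_def s2_def)

lemma norm_B_finite: "mixed_nn_norm q1 (B k) < top"
  by (rule le_less_trans[OF norm_B(1)]) (simp add: ennreal_mult_less_top)

text \<open>On B_j the integral T g is dominated by 2^(j \<tau>) M g, whose integral is controlled
  by Hoelder with q2 and the assumed bound. By symmetry of the kernel the left side pairs g with T
  (B j), so this acts as a dual-norm bound for the oscillation of b on B_j. The exponent is \<tau> +
  N - s2 = 2N - s1.\<close>

lemma pairing_le:
  obtains K where "K < top" "\<And>g j. g \<in> borel_measurable lebesgue \<Longrightarrow> mixed_nn_norm q1 g < top \<Longrightarrow>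
    (\<And>y. y \<notin> dyadic_ball j \<Longrightarrow> g y = 0) \<Longrightarrow>
    (\<integral>\<^sup>+x. B j x * T g x \<partial>lebesgue) \<le> K * pw (j * (2 * N - s1)) * mixed_nn_norm q1 g"
proof
  let ?K = "ennreal (V powr \<theta>) * pw \<tau> * ennreal (4 ^ CARD('n)) * ennreal D"
  show "?K < top" by (simp add: ennreal_mult_less_top)
  fix g and j :: int
  assume g [measurable]: "g \<in> borel_measurable lebesgue" and fin: "mixed_nn_norm q1 g < top"
    and supp: "\<And>y. y \<notin> dyadic_ball j \<Longrightarrow> g y = 0"
  note [measurable] = measurable_max_comm[OF g fin]
  let ?c = "ennreal (V powr \<theta>) * pw \<tau> * pw (j * \<tau>)"
  have "(\<integral>\<^sup>+x. B j x * T g x \<partial>lebesgue) \<le> (\<integral>\<^sup>+x. ?c * (M g x * B j x) \<partial>lebesgue)"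
    by (intro nn_integral_mono) (use supp comm_integral_le_max_comm in \<open>auto simp: indicator_def\<close>)
  also have "\<dots> = ?c * (\<integral>\<^sup>+x. M g x * B j x \<partial>lebesgue)"
    by (rule nn_integral_cmult) measurable
  also have "\<dots> \<le> ?c * (ennreal (4 ^ CARD('n) * 2 powr (j * (N - s2))) * mixed_nn_norm q2 (\<lambda>x. M g x * B j x))"
    unfolding N_def s2_def by (intro mult_left_mono nn_integral_dyadic_ball_le q2) auto
  also have "\<dots> \<le> ?c * (ennreal (4 ^ CARD('n) * 2 powr (j * (N - s2))) * (ennreal D * mixed_nn_norm q1 g))"
    by (intro mult_left_mono order_trans[OF mixed_nn_norm_mono max_comm_bound[OF g fin]])
       (auto simp: indicator_def q_pos)
  also have "\<dots> = ?K * (pw (j * \<tau>) * pw (j * (N - s2))) * mixed_nn_norm q1 g"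
    by (simp add: ennreal_mult mult_ac)
  also have "pw (j * \<tau>) * pw (j * (N - s2)) = pw (j * (2 * N - s1))"
    unfolding pw_mult by (simp add: \<tau>_def algebra_simps)
  finally show "(\<integral>\<^sup>+x. B j x * T g x \<partial>lebesgue) \<le> ?K * pw (j * (2 * N - s1)) * mixed_nn_norm q1 g" .
qed

text \<open>Here the assumed bound is tested on the indicator of B_k; up to the factor |B_k|, T (B
  k) x is the mean of |b x - b y| over y \<in> B_k. The exponent is \<tau> + s1 = N + s2.\<close>

lemma norm_comm_integral_same_ball:
  obtains K where "K < top" "\<And>k. mixed_nn_norm q2 (\<lambda>x. B k x * T (B k) x) \<le> K * pw (k * (N + s2))"
proof
  let ?K = "ennreal (V powr \<theta>) * pw \<tau> * (ennreal D * ennreal (2 ^ CARD('n)))"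
  show "?K < top" by (simp add: ennreal_mult_less_top)
  fix k :: int
  have B: "B k \<in> borel_measurable lebesgue" by measurable
  note [measurable] = measurable_max_comm[OF B norm_B_finite]
  let ?c = "ennreal (V powr \<theta>) * pw \<tau> * pw (k * \<tau>)"
  have "mixed_nn_norm q2 (\<lambda>x. B k x * T (B k) x) \<le> mixed_nn_norm q2 (\<lambda>x. ?c * M (B k) x)"
    by (intro mixed_nn_norm_mono q_pos) (use comm_integral_le_max_comm[of _ k "B k"] in \<open>auto simp: indicator_def\<close>)
  also have "\<dots> = ?c * mixed_nn_norm q2 (M (B k))"
    by (intro mixed_nn_norm_cmult q_pos) measurable
  also have "\<dots> \<le> ?c * (ennreal D * (ennreal (2 ^ CARD('n)) * pw (k * s1)))"
    by (intro mult_left_mono order_trans[OF max_comm_bound[OF B norm_B_finite]] norm_B) auto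
  also have "\<dots> = ?K * (pw (k * \<tau>) * pw (k * s1))"
    by (simp add: mult_ac)
  also have "pw (k * \<tau>) * pw (k * s1) = pw (k * (N + s2))"
    unfolding pw_mult by (simp add: \<tau>_def algebra_simps)
  finally show "mixed_nn_norm q2 (\<lambda>x. B k x * T (B k) x) \<le> ?K * pw (k * (N + s2))" .
qed

text \<open>Not normalised: dividing by |B_j| |B_k| gives the mean of |b x - b y| over the two
  balls, which explains the factor 2^((j+k)N) in its bounds.\<close>

definition "osc j k = (\<integral>\<^sup>+x. B j x * T (B k) x \<partial>lebesgue)"

lemma osc_commute: "osc j k = osc k j"
  unfolding osc_def by (rule nn_integral_comm_integral_commute) measurable

text \<open>Normalised by both volumes, the bound grows by a fixed amount with each ball inserted
  between B_k and B_(k+d), hence linearly in d.\<close>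

lemma osc_le_aux:
  obtains K where "K < top"
    "\<And>k d. osc k (k + int d) \<le> ennreal (real d + 1) * K * pw ((2 * real_of_int k + real d) * N)"
proof -
  obtain K0 where K0: "K0 < top" and pair: "\<And>g j. g \<in> borel_measurable lebesgue \<Longrightarrow> mixed_nn_norm q1 g < top \<Longrightarrow>
    (\<And>y. y \<notin> dyadic_ball j \<Longrightarrow> g y = 0) \<Longrightarrow>
    (\<integral>\<^sup>+x. B j x * T g x \<partial>lebesgue) \<le> K0 * pw (j * (2 * N - s1)) * mixed_nn_norm q1 g"
    using pairing_le by blast
  define K1 where "K1 = K0 * ennreal (2 ^ CARD('n))"
  \<comment> \<open>The factor 2^N pays for replacing B_k by B_(k+1) in \<open>next_ball\<close>; it
    also makes K \<ge> K1 for the start of the induction.\<close>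
  define K where "K = K1 * pw N"
  have diag: "osc k k \<le> K1 * pw (2 * real_of_int k * N)" for k
  proof -
    have "osc k k \<le> K0 * pw (k * (2 * N - s1)) * mixed_nn_norm q1 (B k)"
      unfolding osc_def by (rule pair) (auto simp: norm_B_finite)
    also have "\<dots> \<le> K0 * pw (k * (2 * N - s1)) * (ennreal (2 ^ CARD('n)) * pw (k * s1))"
      by (intro mult_left_mono norm_B) auto
    also have "\<dots> = K1 * (pw (k * (2 * N - s1)) * pw (k * s1))"
      by (simp add: K1_def mult_ac)
    also have "pw (k * (2 * N - s1)) * pw (k * s1) = pw (2 * real_of_int k * N)"
      unfolding pw_mult by (simp add: algebra_simps)
    finally show ?thesis .
  qed
  have next_ball: "osc k (k + 1) \<le> K * pw ((2 * real_of_int k + 1) * N)" for k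
  proof -
    have "osc k (k + 1) \<le> osc (k + 1) (k + 1)"
      unfolding osc_def using dyadic_ball_mono[of k "k + 1", where 'a = 'n]
      by (intro nn_integral_mono mult_right_mono) (auto simp: indicator_def)
    also have "\<dots> \<le> K1 * pw (2 * real_of_int (k + 1) * N)"
      by (rule diag)
    also have "2 * real_of_int (k + 1) * N = N + (2 * real_of_int k + 1) * N"
      by (simp add: algebra_simps)
    finally show ?thesis by (simp add: K_def pw_mult[symmetric] mult.assoc)
  qed
  have "osc k (k + int d) \<le> ennreal (real d + 1) * K * pw ((2 * real_of_int k + real d) * N)" for k d
  proof (induction d)
    case 0
    have "K1 * 1 \<le> K1 * pw N"
      by (intro mult_left_mono) (auto simp: N_def ge_one_powr_ge_zero simp flip: ennreal_1 intro!: ennreal_leI)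
    then have "K1 * pw (2 * real_of_int k * N) \<le> K * pw (2 * real_of_int k * N)"
      by (intro mult_right_mono) (auto simp: K_def)
    with diag[of k] show ?case by simp
  next
    case (Suc d)
    let ?m = "k + int d"
    \<comment> \<open>With B_m as the intermediate ball, m = k + d, one term compares adjacent balls
      and the other falls under the induction hypothesis; the common factor |B_m| cancels at the
      end.\<close>
    have "ennreal V * pw (real_of_int ?m * N) * osc k (?m + 1)
        \<le> ennreal V * pw (k * N) * osc ?m (?m + 1) + ennreal V * pw (real_of_int (?m + 1) * N) * osc k ?m"
      unfolding osc_def nn_integral_B[symmetric] by (rule nn_integral_comm_integral_triangle) measurable
    also have "\<dots> \<le> ennreal V * pw (k * N) * (K * pw ((2 * real_of_int ?m + 1) * N))
        + ennreal V * pw (real_of_int (?m + 1) * N) * (ennreal (real d + 1) * K * pw ((2 * real_of_int k + real d) * N))"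
      by (intro add_mono mult_left_mono next_ball Suc.IH) auto
    also have "\<dots> = ennreal V * K * (pw (k * N) * pw ((2 * real_of_int ?m + 1) * N))
        + ennreal V * ennreal (real d + 1) * K * (pw (real_of_int (?m + 1) * N) * pw ((2 * real_of_int k + real d) * N))"
      by (simp only: mult_ac)
    also have "pw (k * N) * pw ((2 * real_of_int ?m + 1) * N) = pw (real_of_int ?m * N) * pw ((2 * real_of_int k + real (Suc d)) * N)"
      unfolding pw_mult by (simp add: algebra_simps)
    also have "pw (real_of_int (?m + 1) * N) * pw ((2 * real_of_int k + real d) * N) = pw (real_of_int ?m * N) * pw ((2 * real_of_int k + real (Suc d)) * N)"
      unfolding pw_mult by (simp add: algebra_simps)
    also have "ennreal V * K * (pw (real_of_int ?m * N) * pw ((2 * real_of_int k + real (Suc d)) * N))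
        + ennreal V * ennreal (real d + 1) * K * (pw (real_of_int ?m * N) * pw ((2 * real_of_int k + real (Suc d)) * N))
      = ennreal V * pw (real_of_int ?m * N) * ((1 + ennreal (real d + 1)) * K * pw ((2 * real_of_int k + real (Suc d)) * N))"
      by (simp only: distrib_left distrib_right mult_1_left mult_ac)
    also have "1 + ennreal (real d + 1) = ennreal (real (Suc d) + 1)"
      by (simp add: ennreal_plus[symmetric] del: ennreal_plus flip: ennreal_1)
    finally show ?case
      using V_pos by (subst (asm) ennreal_mult_le_mult_iff)
        (auto simp: ennreal_mult_eq_top_iff ennreal_eq_0_iff add.assoc add.commute[of 1 "int d"])
  qed
  moreover have "K < top" using K0 by (simp add: K_def K1_def ennreal_mult_less_top)
  ultimately show ?thesis using that by blast
qed

lemma osc_le: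
  obtains K where "K < top"
    "\<And>j k. osc j k \<le> ennreal (real_of_int \<bar>j - k\<bar> + 1) * K * pw ((real_of_int j + real_of_int k) * N)"
proof -
  obtain K where K: "K < top"
    "\<And>k d. osc k (k + int d) \<le> ennreal (real d + 1) * K * pw ((2 * real_of_int k + real d) * N)"
    using osc_le_aux by blast
  have le: "osc j k \<le> ennreal (real_of_int (k - j) + 1) * K * pw ((real_of_int j + real_of_int k) * N)" if "j \<le> k" for j k
  proof -
    have "real (nat (k - j)) = real_of_int k - real_of_int j" "j + int (nat (k - j)) = k"
      using that by simp_all
    with K(2)[of j "nat (k - j)"] show ?thesis by (simp del: ennreal_plus)
  qed
  show ?thesis
  proof (rule that[OF K(1)])
    fix j k
    show "osc j k \<le> ennreal (real_of_int \<bar>j - k\<bar> + 1) * K * pw ((real_of_int j + real_of_int k) * N)"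
      using le[of j k] le[of k j] by (cases "j \<le> k") (simp_all add: osc_commute[of j k] add.commute)
  qed
qed

lemma cancel_measure:
  assumes "ennreal V * pw a * X \<le> Y"
  shows "X \<le> ennreal (1 / V) * pw (- a) * Y"
proof -
  have "ennreal (1 / V) * pw (- a) * (ennreal V * pw a * X) = ennreal (1 / V * V) * (pw (- a) * pw a) * X"
    using V_pos by (subst ennreal_mult) (simp_all add: mult_ac)
  also have "\<dots> = X" using V_pos by (simp add: pw_mult)
  finally have "X = ennreal (1 / V) * pw (- a) * (ennreal V * pw a * X)" by simp
  also have "\<dots> \<le> ennreal (1 / V) * pw (- a) * Y" by (intro mult_left_mono assms) simp
  finally show ?thesis .
qed

text \<open>Averaging the intermediate point over B_k gives T (B j) \<le> (|B_j|/|B_k|) T (B k) +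
  osc k j / |B_k|. The first term is the same-ball case; the second is constant, so only the norm of
  the indicator of B_k enters.\<close>

lemma norm_comm_integral_B:
  obtains K where "K < top"
    "\<And>j k. mixed_nn_norm q2 (\<lambda>x. B k x * T (B j) x) \<le> ennreal (real_of_int \<bar>j - k\<bar> + 1) * K * pw (j * N + k * s2)"
proof -
  obtain K1 where K1: "K1 < top" "\<And>k. mixed_nn_norm q2 (\<lambda>x. B k x * T (B k) x) \<le> K1 * pw (k * (N + s2))"
    using norm_comm_integral_same_ball by blast
  obtain K2 where K2: "K2 < top" "\<And>j k. osc j k \<le> ennreal (real_of_int \<bar>j - k\<bar> + 1) * K2 * pw ((real_of_int j + real_of_int k) * N)"
    using osc_le by blast
  define K where "K = K1 + ennreal (1 / V) * K2 * ennreal (2 ^ CARD('n))"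
  have "mixed_nn_norm q2 (\<lambda>x. B k x * T (B j) x) \<le> ennreal (real_of_int \<bar>j - k\<bar> + 1) * K * pw (j * N + k * s2)" for j k
  proof -
    let ?e = "ennreal (real_of_int \<bar>j - k\<bar> + 1)"
    let ?c = "ennreal (1 / V) * pw (- (real_of_int k * N))"
    have e1: "1 * z \<le> ?e * z" for z
      by (intro mult_right_mono) (auto simp flip: ennreal_1 intro!: ennreal_leI)
    have one: "ennreal (1 / V) * ennreal V = 1"
      using V_pos by (simp add: ennreal_mult[symmetric])
    have pt: "B k x * T (B j) x \<le> pw ((real_of_int j - real_of_int k) * N) * (B k x * T (B k) x) + ?c * osc k j * B k x" for x
    proof -
      have "T (B j) x \<le> ?c * (ennreal V * pw (j * N) * T (B k) x + osc k j)"
        unfolding osc_def nn_integral_B[symmetric]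
        by (rule cancel_measure, unfold nn_integral_B[symmetric], rule comm_integral_triangle) measurable
      also have "\<dots> = (ennreal (1 / V) * ennreal V) * (pw (- (real_of_int k * N)) * pw (j * N)) * T (B k) x + ?c * osc k j"
        by (simp only: distrib_left mult_ac)
      also have "\<dots> = pw ((real_of_int j - real_of_int k) * N) * T (B k) x + ?c * osc k j"
        unfolding one pw_mult by (simp add: algebra_simps)
      finally have "B k x * T (B j) x \<le> B k x * (pw ((real_of_int j - real_of_int k) * N) * T (B k) x + ?c * osc k j)"
        by (rule mult_left_mono) simp
      then show ?thesis by (simp only: distrib_left mult_ac)
    qed
    have "mixed_nn_norm q2 (\<lambda>x. B k x * T (B j) x)
        \<le> mixed_nn_norm q2 (\<lambda>x. pw ((real_of_int j - real_of_int k) * N) * (B k x * T (B k) x) + ?c * osc k j * B k x)"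
      by (intro mixed_nn_norm_mono q_pos pt)
    also have "\<dots> \<le> mixed_nn_norm q2 (\<lambda>x. pw ((real_of_int j - real_of_int k) * N) * (B k x * T (B k) x)) + mixed_nn_norm q2 (\<lambda>x. ?c * osc k j * B k x)"
      by (intro mixed_nn_norm_add q2) measurable
    also have "\<dots> = pw ((real_of_int j - real_of_int k) * N) * mixed_nn_norm q2 (\<lambda>x. B k x * T (B k) x) + ?c * osc k j * mixed_nn_norm q2 (B k)"
      by (subst (1 2) mixed_nn_norm_cmult) (auto simp: q_pos)
    also have "\<dots> \<le> pw ((real_of_int j - real_of_int k) * N) * (K1 * pw (k * (N + s2)))
        + ?c * (ennreal (real_of_int \<bar>k - j\<bar> + 1) * K2 * pw ((real_of_int k + real_of_int j) * N)) * (ennreal (2 ^ CARD('n)) * pw (k * s2))"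
      by (intro add_mono mult_mono mult_left_mono K1 K2 norm_B) auto
    also have "\<dots> = K1 * (pw ((real_of_int j - real_of_int k) * N) * pw (k * (N + s2)))
        + ?e * (ennreal (1 / V) * K2 * ennreal (2 ^ CARD('n))) * (pw (- (real_of_int k * N)) * pw ((real_of_int k + real_of_int j) * N) * pw (k * s2))"
      by (simp only: abs_minus_commute[of k j] mult_ac)
    also have "pw ((real_of_int j - real_of_int k) * N) * pw (k * (N + s2)) = pw (j * N + k * s2)"
      unfolding pw_mult by (simp add: algebra_simps)
    also have "pw (- (real_of_int k * N)) * pw ((real_of_int k + real_of_int j) * N) * pw (k * s2) = pw (j * N + k * s2)"
      unfolding pw_mult by (simp add: algebra_simps)
    also have "K1 * pw (j * N + k * s2) + ?e * (ennreal (1 / V) * K2 * ennreal (2 ^ CARD('n))) * pw (j * N + k * s2)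
      \<le> ?e * (K1 * pw (j * N + k * s2)) + ?e * (ennreal (1 / V) * K2 * ennreal (2 ^ CARD('n))) * pw (j * N + k * s2)"
      using e1 by (intro add_right_mono) simp
    also have "\<dots> = ?e * K * pw (j * N + k * s2)"
      by (simp only: K_def distrib_left distrib_right mult_ac)
    finally show ?thesis .
  qed
  moreover have "K < top" using K1(1) K2(1) by (simp add: K_def ennreal_mult_less_top)
  ultimately show ?thesis using that by blast
qed

text \<open>This time the intermediate point runs over B_j. The x-dependent term is the integral of
  g, bounded by Hoelder, times T (B j); the remaining constant is bounded by
  \<open>pairing_le\<close>. Both lead to the same power of two.\<close>

lemma norm_comm_integral:
  obtains K where "K < top"
    "\<And>g j k. g \<in> borel_measurable lebesgue \<Longrightarrow> mixed_nn_norm q1 g < top \<Longrightarrow>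
      (\<And>y. y \<notin> dyadic_ball j \<Longrightarrow> g y = 0) \<Longrightarrow>
      mixed_nn_norm q2 (\<lambda>x. B k x * T g x)
        \<le> ennreal (real_of_int \<bar>j - k\<bar> + 1) * K * pw (j * (N - s1) + k * s2) * mixed_nn_norm q1 g"
proof -
  obtain K1 where K1: "K1 < top"
    "\<And>j k. mixed_nn_norm q2 (\<lambda>x. B k x * T (B j) x) \<le> ennreal (real_of_int \<bar>j - k\<bar> + 1) * K1 * pw (j * N + k * s2)"
    using norm_comm_integral_B by blast
  obtain K2 where K2: "K2 < top" "\<And>g j. g \<in> borel_measurable lebesgue \<Longrightarrow> mixed_nn_norm q1 g < top \<Longrightarrow>
    (\<And>y. y \<notin> dyadic_ball j \<Longrightarrow> g y = 0) \<Longrightarrow>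
    (\<integral>\<^sup>+x. B j x * T g x \<partial>lebesgue) \<le> K2 * pw (j * (2 * N - s1)) * mixed_nn_norm q1 g"
    using pairing_le by blast
  define K where "K = ennreal (1 / V) * ennreal (4 ^ CARD('n)) * K1 + ennreal (1 / V) * K2 * ennreal (2 ^ CARD('n))"
  have "mixed_nn_norm q2 (\<lambda>x. B k x * T g x)
      \<le> ennreal (real_of_int \<bar>j - k\<bar> + 1) * K * pw (j * (N - s1) + k * s2) * mixed_nn_norm q1 g"
    if g [measurable]: "g \<in> borel_measurable lebesgue" and fin: "mixed_nn_norm q1 g < top"
      and supp: "\<And>y. y \<notin> dyadic_ball j \<Longrightarrow> g y = 0" for g j k
  proof -
    let ?e = "ennreal (real_of_int \<bar>j - k\<bar> + 1)"
    let ?c = "ennreal (1 / V) * pw (- (real_of_int j * N))"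
    let ?I = "\<integral>\<^sup>+y. g y \<partial>lebesgue" and ?J = "\<integral>\<^sup>+x. B j x * T g x \<partial>lebesgue"
    let ?n = "mixed_nn_norm q1 g"
    let ?p = "pw (j * (N - s1) + k * s2)"
    have e1: "1 * z \<le> ?e * z" for z
      by (intro mult_right_mono) (auto simp flip: ennreal_1 intro!: ennreal_leI)
    have pt: "B k x * T g x \<le> ?c * ?I * (B k x * T (B j) x) + ?c * ?J * B k x" for x
    proof -
      have "T g x \<le> ?c * (?I * T (B j) x + ?J)"
        by (rule cancel_measure, unfold nn_integral_B[symmetric], rule comm_integral_triangle) measurable
      then have "B k x * T g x \<le> B k x * (?c * (?I * T (B j) x + ?J))"
        by (rule mult_left_mono) simp
      then show ?thesis by (simp only: distrib_left mult_ac)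
    qed
    have I: "?I \<le> ennreal (4 ^ CARD('n)) * pw (j * (N - s1)) * ?n"
      using nn_integral_dyadic_ball_le[OF q1 g supp] by (simp add: ennreal_mult N_def s1_def)
    have "mixed_nn_norm q2 (\<lambda>x. B k x * T g x)
        \<le> mixed_nn_norm q2 (\<lambda>x. ?c * ?I * (B k x * T (B j) x) + ?c * ?J * B k x)"
      by (intro mixed_nn_norm_mono q_pos pt)
    also have "\<dots> \<le> mixed_nn_norm q2 (\<lambda>x. ?c * ?I * (B k x * T (B j) x)) + mixed_nn_norm q2 (\<lambda>x. ?c * ?J * B k x)"
      by (intro mixed_nn_norm_add q2) measurable
    also have "\<dots> = ?c * ?I * mixed_nn_norm q2 (\<lambda>x. B k x * T (B j) x) + ?c * ?J * mixed_nn_norm q2 (B k)"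
      by (subst (1 2) mixed_nn_norm_cmult) (auto simp: q_pos)
    also have "\<dots> \<le> ?c * (ennreal (4 ^ CARD('n)) * pw (j * (N - s1)) * ?n) * (?e * K1 * pw (j * N + k * s2))
        + ?c * (K2 * pw (j * (2 * N - s1)) * ?n) * (ennreal (2 ^ CARD('n)) * pw (k * s2))"
      using K2(2)[OF g fin supp] by (intro add_mono mult_mono mult_left_mono I K1 norm_B) auto
    also have "\<dots> = ?e * (ennreal (1 / V) * ennreal (4 ^ CARD('n)) * K1)
          * (pw (- (real_of_int j * N)) * pw (j * (N - s1)) * pw (j * N + k * s2)) * ?n
        + ennreal (1 / V) * K2 * ennreal (2 ^ CARD('n)) * (pw (- (real_of_int j * N)) * pw (j * (2 * N - s1)) * pw (k * s2)) * ?n"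
      by (simp only: mult_ac)
    also have "pw (- (real_of_int j * N)) * pw (j * (N - s1)) * pw (j * N + k * s2) = ?p"
      unfolding pw_mult by (simp add: algebra_simps)
    also have "pw (- (real_of_int j * N)) * pw (j * (2 * N - s1)) * pw (k * s2) = ?p"
      unfolding pw_mult by (simp add: algebra_simps)
    also have "?e * (ennreal (1 / V) * ennreal (4 ^ CARD('n)) * K1) * ?p * ?n
        + ennreal (1 / V) * K2 * ennreal (2 ^ CARD('n)) * ?p * ?n
      \<le> ?e * (ennreal (1 / V) * ennreal (4 ^ CARD('n)) * K1) * ?p * ?n
        + ?e * (ennreal (1 / V) * K2 * ennreal (2 ^ CARD('n)) * ?p * ?n)"
      using e1 by (intro add_left_mono) simp
    also have "\<dots> = ?e * K * ?p * ?n"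
      by (simp only: K_def distrib_left distrib_right mult_ac)
    finally show ?thesis .
  qed
  moreover have "K < top" using K1(1) K2(1) by (simp add: K_def ennreal_mult_less_top)
  ultimately show ?thesis using that by blast
qed

text \<open>For |j - k| \<ge> 2 the maximal function is dominated by T g; neighbouring shells use
  the hypothesis directly. Since \<tau> = N - s1 + s2, the exponent equals -(k - j)(N - s1) for j
  \<le> k and -(j - k) s2 for j \<ge> k.\<close>

lemma norm_max_comm_shell:
  obtains K where "K < top"
    "\<And>g j k. g \<in> borel_measurable lebesgue \<Longrightarrow> mixed_nn_norm q1 g < top \<Longrightarrow>
      (\<And>y. y \<notin> dyadic_shell j \<Longrightarrow> g y = 0) \<Longrightarrow>
      mixed_nn_norm q2 (\<lambda>x. M g x * indicator (dyadic_shell k) x)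
        \<le> ennreal (real_of_int \<bar>j - k\<bar> + 1) * K * pw (j * (N - s1) + k * s2 - real_of_int (max j k) * \<tau>) * mixed_nn_norm q1 g"
proof -
  obtain K1 where K1: "K1 < top"
    "\<And>g j k. g \<in> borel_measurable lebesgue \<Longrightarrow> mixed_nn_norm q1 g < top \<Longrightarrow>
      (\<And>y. y \<notin> dyadic_ball j \<Longrightarrow> g y = 0) \<Longrightarrow>
      mixed_nn_norm q2 (\<lambda>x. B k x * T g x)
        \<le> ennreal (real_of_int \<bar>j - k\<bar> + 1) * K1 * pw (j * (N - s1) + k * s2) * mixed_nn_norm q1 g"
    using norm_comm_integral by blast
  \<comment> \<open>For |j - k| \<le> 1 the exponent is 0, -(N - s1) or -s2; this factor makes up
    for it, so that one formula serves all j and k.\<close>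
  define K2 where "K2 = ennreal D * pw (\<bar>N - s1\<bar> + \<bar>s2\<bar>)"
  define K3 where "K3 = ennreal (V powr (- \<theta>)) * pw (2 * \<tau>) * K1"
  have "mixed_nn_norm q2 (\<lambda>x. M g x * indicator (dyadic_shell k) x)
        \<le> ennreal (real_of_int \<bar>j - k\<bar> + 1) * (K2 + K3) * pw (j * (N - s1) + k * s2 - real_of_int (max j k) * \<tau>) * mixed_nn_norm q1 g"
    if g [measurable]: "g \<in> borel_measurable lebesgue" and fin: "mixed_nn_norm q1 g < top"
      and supp: "\<And>y. y \<notin> dyadic_shell j \<Longrightarrow> g y = 0" for g j k
  proof -
    let ?e = "ennreal (real_of_int \<bar>j - k\<bar> + 1)"
    let ?p = "pw (j * (N - s1) + k * s2 - real_of_int (max j k) * \<tau>)"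
    let ?n = "mixed_nn_norm q1 g"
    show ?thesis
    proof (cases "2 \<le> \<bar>j - k\<bar>")
      case True
      let ?c = "ennreal (V powr (- \<theta>)) * pw (2 * \<tau>) * pw (- real_of_int (max j k) * \<tau>)"
      have "mixed_nn_norm q2 (\<lambda>x. M g x * indicator (dyadic_shell k) x) \<le> mixed_nn_norm q2 (\<lambda>x. ?c * (B k x * T g x))"
        by (intro mixed_nn_norm_mono q_pos)
          (use max_comm_le_comm_integral[OF _ supp True] in \<open>auto simp: indicator_def dyadic_shell_def\<close>)
      also have "\<dots> = ?c * mixed_nn_norm q2 (\<lambda>x. B k x * T g x)"
        by (intro mixed_nn_norm_cmult q_pos) measurable
      also have "\<dots> \<le> ?c * (?e * K1 * pw (j * (N - s1) + k * s2) * ?n)"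
        using supp by (intro mult_left_mono K1(2) g fin) (auto simp: dyadic_shell_def)
      also have "\<dots> = ?e * K3 * (pw (j * (N - s1) + k * s2) * pw (- real_of_int (max j k) * \<tau>)) * ?n"
        by (simp only: K3_def mult_ac)
      also have "pw (j * (N - s1) + k * s2) * pw (- real_of_int (max j k) * \<tau>) = ?p"
        unfolding pw_mult by simp
      also have "?e * K3 * ?p * ?n \<le> ?e * (K2 + K3) * ?p * ?n"
        by (intro mult_right_mono mult_left_mono) auto
      finally show ?thesis .
    next
      case False
      have "0 \<le> \<bar>N - s1\<bar> + \<bar>s2\<bar> + (j * (N - s1) + k * s2 - real_of_int (max j k) * \<tau>)"
      proof -
        consider "k = j" | "k = j + 1" | "j = k + 1" using False by linarith
        then show ?thesis
          by cases (auto simp: \<tau>_def algebra_simps)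
      qed
      then have "1 * 1 \<le> ?e * pw (\<bar>N - s1\<bar> + \<bar>s2\<bar> + (j * (N - s1) + k * s2 - real_of_int (max j k) * \<tau>))"
        by (intro mult_mono) (auto simp: ge_one_powr_ge_zero simp flip: ennreal_1 intro!: ennreal_leI)
      then have ep: "1 \<le> ?e * (pw (\<bar>N - s1\<bar> + \<bar>s2\<bar>) * ?p)"
        by (simp add: pw_mult)
      have "mixed_nn_norm q2 (\<lambda>x. M g x * indicator (dyadic_shell k) x) \<le> mixed_nn_norm q2 (M g)"
        by (intro mixed_nn_norm_mono q_pos) (auto simp: indicator_def)
      also have "\<dots> \<le> ennreal D * ?n * 1" using max_comm_bound[OF g fin] by simp
      also have "\<dots> \<le> ennreal D * ?n * (?e * (pw (\<bar>N - s1\<bar> + \<bar>s2\<bar>) * ?p))"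
        by (intro mult_left_mono ep) simp
      also have "\<dots> = ?e * K2 * ?p * ?n"
        by (simp only: K2_def mult_ac)
      also have "\<dots> \<le> ?e * (K2 + K3) * ?p * ?n"
        by (intro mult_right_mono mult_left_mono) auto
      finally show ?thesis .
    qed
  qed
  moreover have "K2 + K3 < top" using K1(1) by (simp add: K2_def K3_def ennreal_mult_less_top)
  ultimately show ?thesis using that by blast
qed

end

section \<open>Weighted sequence norms\<close>

text \<open>The weight 2^(k \<alpha>) is absorbed into the sequence U, so that both Herz-Morrey
  norms become sequence norms that differ only in p.\<close>

definition herz_seq_norm :: "real \<Rightarrow> ennreal \<Rightarrow> (int \<Rightarrow> ennreal) \<Rightarrow> ennreal" where
  "herz_seq_norm lam p U = (SUP k0::int. pw (- of_int k0 * lam) *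
     (if p = \<infinity> then (SUP k\<in>{..k0}. U k)
      else ennpowr (\<Sum>\<^sub>\<infinity>k\<in>{..k0}. ennpowr (U k) (enn2real p)) (1 / enn2real p)))"

lemma shell_norm_eq:
  assumes "\<And>i. 0 < q $ i"
  shows "shell_norm q f k = mixed_nn_norm q (\<lambda>x. e2ennreal \<bar>f x\<bar> * indicator (dyadic_shell k) x)"
proof -
  have "e2ennreal \<bar>f x * indicator A x\<bar> = e2ennreal \<bar>f x\<bar> * indicator A x" for x and A :: "(real ^ 'a::{finite,linorder}) set"
    by (simp add: indicator_def e2ennreal_neg)
  then show ?thesis using assms by (simp add: shell_norm_def mixed_norm_eq)
qed

lemma herz_morrey_norm_eq:
  fixes \<alpha> lam :: real
  assumes "0 < p"
  shows "herz_morrey_norm \<alpha> lam p q f = herz_seq_norm lam p (\<lambda>k. pw (real_of_int k * \<alpha>) * shell_norm q f k)"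
proof -
  have "ennreal (2 powr (of_int k * \<alpha> * enn2real p)) * ennpowr (shell_norm q f k) (enn2real p)
      = ennpowr (pw (real_of_int k * \<alpha>) * shell_norm q f k) (enn2real p)" if "p \<noteq> \<infinity>" for k
  proof -
    have "0 < enn2real p" using assms that by (simp add: enn2real_positive_iff less_top)
    then show ?thesis by (simp add: ennpowr_mult powr_powr)
  qed
  then show ?thesis
    unfolding herz_morrey_norm_def herz_seq_norm_def by (intro SUP_cong refl) auto
qed

section \<open>Bounds through finite sums, and inclusion in the exponent p\<close>

lemma pw_mult_le_iff: "pw (- a) * X \<le> Y \<longleftrightarrow> X \<le> pw a * Y"
proof -
  have "pw a * (pw (- a) * X) \<le> pw a * Y \<longleftrightarrow> pw (- a) * X \<le> Y"
    by (rule ennreal_mult_le_mult_iff) auto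
  then show ?thesis by (simp add: pw_mult_left)
qed

lemma infsum_ennreal_le_iff:
  fixes f :: "'a \<Rightarrow> ennreal"
  shows "infsum f A \<le> X \<longleftrightarrow> (\<forall>F. finite F \<and> F \<subseteq> A \<longrightarrow> sum f F \<le> X)"
  by (subst nonneg_infsum_complete) (auto simp: SUP_le_iff)

lemma herz_seq_norm_top_le_iff:
  "herz_seq_norm lam top U \<le> X \<longleftrightarrow> (\<forall>k0 k. k \<le> k0 \<longrightarrow> U k \<le> pw (real_of_int k0 * lam) * X)"
proof -
  have "pw (- real_of_int k0 * lam) * S \<le> X \<longleftrightarrow> S \<le> pw (real_of_int k0 * lam) * X" for k0 S
    using pw_mult_le_iff[of "real_of_int k0 * lam" S X] by simp
  then show ?thesis by (auto simp: herz_seq_norm_def SUP_le_iff)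
qed

text \<open>Raising to the power r removes the supremum and the infinite sum: what remains are
  finite sums, which can be shifted in k and exchanged with integrals.\<close>

lemma herz_seq_norm_le_iff:
  assumes "0 < r"
  shows "herz_seq_norm lam (ennreal r) U \<le> X \<longleftrightarrow>
    (\<forall>k0 F. finite F \<and> F \<subseteq> {..k0} \<longrightarrow> (\<Sum>k\<in>F. ennpowr (U k) r) \<le> ennpowr (pw (real_of_int k0 * lam) * X) r)"
proof -
  have "pw (- real_of_int k0 * lam) * ennpowr S (1 / r) \<le> X \<longleftrightarrow> S \<le> ennpowr (pw (real_of_int k0 * lam) * X) r" for k0 S
    using assms pw_mult_le_iff[of "real_of_int k0 * lam" "ennpowr S (1 / r)" X] ennpowr_le_iff[of "1 / r" S] by simp
  then show ?thesis
    using assms by (simp add: herz_seq_norm_def SUP_le_iff infsum_ennreal_le_iff)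
qed

lemma herz_seq_norm_power_sum_le:
  assumes "0 < r" "finite F" "F \<subseteq> {..k0}"
  shows "(\<Sum>k\<in>F. ennpowr (U k) r) \<le> ennpowr (pw (real_of_int k0 * lam) * herz_seq_norm lam (ennreal r) U) r"
  using herz_seq_norm_le_iff[of r lam U "herz_seq_norm lam (ennreal r) U"] assms by auto

lemma le_herz_seq_norm:
  assumes "0 < p" "k \<le> k0"
  shows "U k \<le> pw (real_of_int k0 * lam) * herz_seq_norm lam p U"
proof (cases p)
  case (real r)
  then have r: "0 < r" using assms by (auto simp: less_le)
  from herz_seq_norm_power_sum_le[OF r, of "{k}" k0 U lam] assms(2)
  have "ennpowr (U k) r \<le> ennpowr (pw (real_of_int k0 * lam) * herz_seq_norm lam p U) r"
    by (simp add: real)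
  then show ?thesis using r by (simp add: ennpowr_le_iff ennpowr_ennpowr)
next
  case top
  then show ?thesis
    using herz_seq_norm_top_le_iff[of lam U "herz_seq_norm lam p U"] assms by auto
qed

text \<open>The inclusion of l^p1 in l^p2: if S bounds all terms, then U^r2 \<le> U^r1 S^(r2 - r1).
  Below k0 such a bound is 2^(k0 lam) times the norm, by \<open>le_herz_seq_norm\<close>, so the
  Morrey factor scales correctly.\<close>

lemma herz_seq_norm_antimono:
  assumes "0 < p1" "p1 \<le> p2"
  shows "herz_seq_norm lam p2 U \<le> herz_seq_norm lam p1 U"
proof (cases p2)
  case top
  then show ?thesis using le_herz_seq_norm[OF assms(1)] by (simp add: herz_seq_norm_top_le_iff)
next
  case (real r2)
  then obtain r1 where r1: "p1 = ennreal r1" "0 \<le> r1"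
    using assms by (cases p1) (auto simp: top_unique)
  have r: "0 < r1" "r1 \<le> r2"
    using assms r1 real by (auto simp: less_le)
  show ?thesis
    unfolding real herz_seq_norm_le_iff[OF less_le_trans[OF r]]
  proof (intro allI impI)
    fix k0 F assume F: "finite F \<and> F \<subseteq> {..k0::int}"
    define S where "S = pw (real_of_int k0 * lam) * herz_seq_norm lam p1 U"
    have U: "U k \<le> S" if "k \<in> F" for k
      unfolding S_def using that F by (intro le_herz_seq_norm assms) auto
    show "(\<Sum>k\<in>F. ennpowr (U k) r2) \<le> ennpowr (pw (real_of_int k0 * lam) * herz_seq_norm lam p1 U) r2"
    proof (cases "S = 0")
      case True
      then have "(\<Sum>k\<in>F. ennpowr (U k) r2) = 0"
        using U by (intro sum.neutral) auto
      then show ?thesis by simp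
    next
      case False
      have "ennpowr (U k) r2 \<le> ennpowr (U k) r1 * ennpowr S (r2 - r1)" if "k \<in> F" for k
      proof (cases "U k = 0")
        case False
        then have "ennpowr (U k) r2 = ennpowr (U k) r1 * ennpowr (U k) (r2 - r1)"
          using ennpowr_add_exponent[of "U k" r1 "r2 - r1"] by simp
        then show ?thesis using U[OF that] r by (simp add: mult_left_mono ennpowr_mono)
      qed simp
      then have "(\<Sum>k\<in>F. ennpowr (U k) r2) \<le> (\<Sum>k\<in>F. ennpowr (U k) r1) * ennpowr S (r2 - r1)"
        by (simp add: sum_distrib_right sum_mono)
      also have "\<dots> \<le> ennpowr S r1 * ennpowr S (r2 - r1)"
        unfolding S_def r1(1) using F r by (intro mult_right_mono herz_seq_norm_power_sum_le) auto
      also have "\<dots> = ennpowr S r2"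
        using ennpowr_add_exponent[OF False, of r1 "r2 - r1"] by simp
      finally show ?thesis by (simp add: S_def)
    qed
  qed
qed

lemma nn_integral_pw_abs_finite:
  assumes "0 < \<epsilon>"
  shows "(\<integral>\<^sup>+d. pw (- \<epsilon> * \<bar>real_of_int d\<bar>) \<partial>count_space UNIV) < top"
proof -
  \<comment> \<open>Half the rate per index, because \<open>int_decode\<close> lists nonnegative and
    negative integers alternately, so that |int_decode m| \<ge> (m - 1)/2.\<close>
  define x where "x = (2 :: real) powr (- \<epsilon> / 2)"
  have x: "0 < x" "x < 1" using assms by (auto simp: x_def powr_less_one)
  have "pw (- \<epsilon> * \<bar>real_of_int (int_decode m)\<bar>) \<le> ennreal (2 powr (\<epsilon> / 2) * x ^ m)" for m
  proof (rule ennreal_leI)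
    have "real m / 2 - 1 / 2 \<le> real_of_int \<bar>int_decode m\<bar>"
      by (auto simp: int_decode_def sum_decode_def field_simps elim!: evenE oddE)
    then have "\<epsilon> * (real m / 2 - 1 / 2) \<le> \<epsilon> * \<bar>real_of_int (int_decode m)\<bar>"
      using assms by (intro mult_left_mono) auto
    then have "2 powr (- \<epsilon> * \<bar>real_of_int (int_decode m)\<bar>) \<le> 2 powr (\<epsilon> / 2 + real m * (- \<epsilon> / 2))"
      by (simp add: field_simps)
    also have "\<dots> = 2 powr (\<epsilon> / 2) * x ^ m"
      unfolding powr_add x_def by (simp add: powr_powr mult.commute flip: powr_realpow)
    finally show "2 powr (- \<epsilon> * \<bar>real_of_int (int_decode m)\<bar>) \<le> 2 powr (\<epsilon> / 2) * x ^ m" .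
  qed
  then have "(\<integral>\<^sup>+d. pw (- \<epsilon> * \<bar>real_of_int d\<bar>) \<partial>count_space UNIV) \<le> (\<Sum>m. ennreal (2 powr (\<epsilon> / 2) * x ^ m))"
    unfolding nn_integral_count_space_int_decode by (intro suminf_le) auto
  also have "\<dots> < top"
    using x by (subst less_top[symmetric]) (intro ennreal_suminf_neq_top summable_mult summable_geometric, auto)
  finally show ?thesis .
qed

text \<open>
  Half of the decay is spent on bounding the sum over \<open>d\<close> by a supremum. Since powers commute with
  suprema and a supremum is at most a sum, all exponents \<open>p > 0\<close> are then treated alike.
\<close>

lemma herz_seq_norm_convolution:
  assumes "0 < \<epsilon>" "0 \<le> lam" "0 < p" "C < top"
  obtains C' where "C' < top"
    "\<And>U V. (\<And>k. V k \<le> C * (\<integral>\<^sup>+d. pw (real_of_int d * lam - 2 * \<epsilon> * \<bar>real_of_int d\<bar>) * U (k - d) \<partial>count_space UNIV))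
      \<Longrightarrow> herz_seq_norm lam p V \<le> C' * herz_seq_norm lam p U"
proof -
  define S where "S = (\<lambda>\<epsilon>. \<integral>\<^sup>+d. pw (- \<epsilon> * \<bar>real_of_int d\<bar>) \<partial>count_space (UNIV :: int set))"
  have S: "S \<delta> < top" if "0 < \<delta>" for \<delta>
    using nn_integral_pw_abs_finite[OF that] by (simp add: S_def)
  show ?thesis
  proof (cases p)
    case top
    show ?thesis
    proof (rule that)
      show "C * S (2 * \<epsilon>) < top" using assms S[of "2 * \<epsilon>"] by (simp add: ennreal_mult_less_top)
      fix U V :: "int \<Rightarrow> ennreal"
      assume V: "\<And>k. V k \<le> C * (\<integral>\<^sup>+d. pw (real_of_int d * lam - 2 * \<epsilon> * \<bar>real_of_int d\<bar>) * U (k - d) \<partial>count_space UNIV)"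
      define X where "X = herz_seq_norm lam p U"
      have "V k \<le> pw (real_of_int k0 * lam) * (C * S (2 * \<epsilon>) * X)" if "k \<le> k0" for k k0
      proof -
        have "(\<integral>\<^sup>+d. pw (real_of_int d * lam - 2 * \<epsilon> * \<bar>real_of_int d\<bar>) * U (k - d) \<partial>count_space UNIV)
            \<le> (\<integral>\<^sup>+d. pw (- (2 * \<epsilon>) * \<bar>real_of_int d\<bar>) * (pw (real_of_int k0 * lam) * X) \<partial>count_space UNIV)"
        proof (intro nn_integral_mono)
          fix d
          \<comment> \<open>As k - d \<le> k0 - d, the Morrey bound at k0 - d applies; its factor
            2^((k0 - d) lam) and the kernel's 2^(d lam) combine to 2^(k0 lam).\<close>
          have "pw (real_of_int d * lam - 2 * \<epsilon> * \<bar>real_of_int d\<bar>) * U (k - d)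
              \<le> pw (real_of_int d * lam - 2 * \<epsilon> * \<bar>real_of_int d\<bar>) * (pw (real_of_int (k0 - d) * lam) * X)"
            unfolding X_def using that by (intro mult_left_mono le_herz_seq_norm assms) auto
          also have "\<dots> = pw (- (2 * \<epsilon>) * \<bar>real_of_int d\<bar>) * (pw (real_of_int k0 * lam) * X)"
            unfolding pw_mult_left by (simp add: algebra_simps)
          finally show "pw (real_of_int d * lam - 2 * \<epsilon> * \<bar>real_of_int d\<bar>) * U (k - d)
            \<le> pw (- (2 * \<epsilon>) * \<bar>real_of_int d\<bar>) * (pw (real_of_int k0 * lam) * X)" .
        qed
        also have "\<dots> = S (2 * \<epsilon>) * (pw (real_of_int k0 * lam) * X)"
          by (simp add: S_def nn_integral_multc)
        finally have "V k \<le> C * (S (2 * \<epsilon>) * (pw (real_of_int k0 * lam) * X))"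
          by (rule order_trans[OF V mult_left_mono]) simp
        then show ?thesis by (simp only: mult_ac)
      qed
      then show "herz_seq_norm lam p V \<le> C * S (2 * \<epsilon>) * herz_seq_norm lam p U"
        by (simp add: top herz_seq_norm_top_le_iff X_def)
    qed
  next
    case (real r)
    then have r: "0 < r" using assms by (auto simp: less_le)
    show ?thesis
    proof (rule that)
      let ?C = "C * S \<epsilon> * ennpowr (S (r * \<epsilon>)) (1 / r)"
      show "?C < top" using assms S[of \<epsilon>] S[of "r * \<epsilon>"] r by (simp add: ennreal_mult_less_top)
      fix U V :: "int \<Rightarrow> ennreal"
      assume V: "\<And>k. V k \<le> C * (\<integral>\<^sup>+d. pw (real_of_int d * lam - 2 * \<epsilon> * \<bar>real_of_int d\<bar>) * U (k - d) \<partial>count_space UNIV)"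
      define X where "X = herz_seq_norm lam p U"
      define w where "w = (\<lambda>d. real_of_int d * lam - \<epsilon> * \<bar>real_of_int d\<bar>)"
      have pow: "ennpowr (V k) r \<le> ennpowr (C * S \<epsilon>) r * (\<integral>\<^sup>+d. pw (r * w d) * ennpowr (U (k - d)) r \<partial>count_space UNIV)" for k
      proof -
        let ?s = "SUP d. pw (w d) * U (k - d)"
        have "(\<integral>\<^sup>+d. pw (real_of_int d * lam - 2 * \<epsilon> * \<bar>real_of_int d\<bar>) * U (k - d) \<partial>count_space UNIV)
            \<le> (\<integral>\<^sup>+d. pw (- \<epsilon> * \<bar>real_of_int d\<bar>) * ?s \<partial>count_space UNIV)"
        proof (intro nn_integral_mono)
          fix d
          have "pw (real_of_int d * lam - 2 * \<epsilon> * \<bar>real_of_int d\<bar>) * U (k - d)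
              = pw (- \<epsilon> * \<bar>real_of_int d\<bar>) * (pw (w d) * U (k - d))"
            unfolding pw_mult_left by (simp add: w_def algebra_simps)
          also have "\<dots> \<le> pw (- \<epsilon> * \<bar>real_of_int d\<bar>) * ?s"
            by (intro mult_left_mono SUP_upper) auto
          finally show "pw (real_of_int d * lam - 2 * \<epsilon> * \<bar>real_of_int d\<bar>) * U (k - d) \<le> pw (- \<epsilon> * \<bar>real_of_int d\<bar>) * ?s" .
        qed
        also have "\<dots> = S \<epsilon> * ?s"
          by (simp add: S_def nn_integral_multc)
        finally have "V k \<le> C * (S \<epsilon> * ?s)"
          by (rule order_trans[OF V mult_left_mono]) simp
        then have "ennpowr (V k) r \<le> ennpowr (C * S \<epsilon> * ?s) r"
          using r by (intro ennpowr_mono) (simp_all add: mult.assoc)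
        also have "\<dots> = ennpowr (C * S \<epsilon>) r * (SUP d. pw (r * w d) * ennpowr (U (k - d)) r)"
          using r by (simp add: ennpowr_mult ennpowr_SUP powr_powr mult.commute)
        also have "\<dots> \<le> ennpowr (C * S \<epsilon>) r * (\<integral>\<^sup>+d. pw (r * w d) * ennpowr (U (k - d)) r \<partial>count_space UNIV)"
          by (intro mult_left_mono SUP_least nn_integral_ge_point) auto
        finally show ?thesis .
      qed
      have "(\<Sum>k\<in>F. ennpowr (V k) r) \<le> ennpowr (pw (real_of_int k0 * lam) * (?C * X)) r"
        if F: "finite F \<and> F \<subseteq> {..k0}" for k0 F
      proof -
        have "(\<Sum>k\<in>F. ennpowr (V k) r)
            \<le> (\<Sum>k\<in>F. ennpowr (C * S \<epsilon>) r * (\<integral>\<^sup>+d. pw (r * w d) * ennpowr (U (k - d)) r \<partial>count_space UNIV))"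
          by (intro sum_mono pow)
        also have "\<dots> = ennpowr (C * S \<epsilon>) r * (\<integral>\<^sup>+d. pw (r * w d) * (\<Sum>k\<in>F. ennpowr (U (k - d)) r) \<partial>count_space UNIV)"
          by (simp add: sum_distrib_left nn_integral_sum)
        also have "\<dots> \<le> ennpowr (C * S \<epsilon>) r * (\<integral>\<^sup>+d. pw (- (r * \<epsilon>) * \<bar>real_of_int d\<bar>) * ennpowr (pw (real_of_int k0 * lam) * X) r \<partial>count_space UNIV)"
        proof (intro mult_left_mono nn_integral_mono)
          fix d
          \<comment> \<open>Shifting F by d moves it below k0 - d, where the Morrey bound on finite
            sums applies; the kernel again compensates the changed factor.\<close>
          have "(\<Sum>k\<in>F. ennpowr (U (k - d)) r) = (\<Sum>k\<in>(\<lambda>k. k - d) ` F. ennpowr (U k) r)"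
            by (subst sum.reindex) (auto simp: inj_on_def)
          also have "\<dots> \<le> ennpowr (pw (real_of_int (k0 - d) * lam) * X) r"
            unfolding X_def real using F by (intro herz_seq_norm_power_sum_le r) auto
          finally have "pw (r * w d) * (\<Sum>k\<in>F. ennpowr (U (k - d)) r)
              \<le> pw (r * w d) * ennpowr (pw (real_of_int (k0 - d) * lam) * X) r"
            by (rule mult_left_mono) simp
          also have "\<dots> = pw (r * w d) * (pw (real_of_int (k0 - d) * lam * r) * ennpowr X r)"
            using r by (simp add: ennpowr_mult powr_powr)
          also have "\<dots> = pw (- (r * \<epsilon>) * \<bar>real_of_int d\<bar>) * (pw (real_of_int k0 * lam * r) * ennpowr X r)"
            unfolding pw_mult_left by (simp add: w_def algebra_simps)
          also have "\<dots> = pw (- (r * \<epsilon>) * \<bar>real_of_int d\<bar>) * ennpowr (pw (real_of_int k0 * lam) * X) r"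
            using r by (simp add: ennpowr_mult powr_powr)
          finally show "pw (r * w d) * (\<Sum>k\<in>F. ennpowr (U (k - d)) r)
            \<le> pw (- (r * \<epsilon>) * \<bar>real_of_int d\<bar>) * ennpowr (pw (real_of_int k0 * lam) * X) r" .
        qed simp
        also have "\<dots> = ennpowr (C * S \<epsilon>) r * (S (r * \<epsilon>) * ennpowr (pw (real_of_int k0 * lam) * X) r)"
          by (simp add: S_def nn_integral_multc)
        also have "\<dots> = ennpowr (pw (real_of_int k0 * lam) * (?C * X)) r"
          using r by (simp add: ennpowr_mult ennpowr_ennpowr mult_ac del: ennpowr_ennreal)
        finally show ?thesis .
      qed
      then show "herz_seq_norm lam p V \<le> ?C * herz_seq_norm lam p U"
        using herz_seq_norm_le_iff[OF r, of lam V "?C * X"] by (simp add: X_def real)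
    qed
  qed
qed

section \<open>Boundedness on Herz-Morrey spaces\<close>

text \<open>A compact exhaustion of the complement of the origin: a function locally in L^q there
  has truncations to these sets in L^q, to which the hypothesis applies.\<close>

definition annulus :: "nat \<Rightarrow> (real ^ 'n) set" where
  "annulus m = {x. 2 powr (- real m) \<le> norm x \<and> norm x \<le> 2 powr real m}"

lemma annulus_eq: "annulus m = cball 0 (2 powr real m) - ball 0 (2 powr (- real m))"
  by (auto simp: annulus_def)

lemma compact_annulus: "compact (annulus m)"
  unfolding annulus_eq by (intro compact_diff compact_cball open_ball)

lemma zero_notin_annulus: "0 \<notin> annulus m"
  by (simp add: annulus_def not_le)

lemma incseq_annulus: "incseq annulus"
proof (rule monoI)
  fix m n :: nat assume "m \<le> n"
  then have "2 powr (- real n) \<le> (2::real) powr (- real m)" "(2::real) powr real m \<le> 2 powr real n"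
    by simp_all
  then show "annulus m \<subseteq> annulus n" unfolding annulus_def by (blast intro: order_trans)
qed

lemma closed_subset_annulus:
  fixes K :: "(real ^ 'n) set"
  assumes "compact K" "0 \<notin> K"
  obtains m where "K \<subseteq> annulus m"
proof -
  obtain a where a: "0 < a" "\<And>x. x \<in> K \<Longrightarrow> norm x \<le> a"
    using compact_imp_bounded[OF assms(1)] by (auto simp: bounded_pos)
  have "open (- K)" using compact_imp_closed[OF assms(1)] by auto
  then obtain c where c: "0 < c" "ball 0 c \<subseteq> - K"
    using assms(2) by (metis ComplI open_contains_ball)
  obtain m1 :: nat where m1: "a < 2 ^ m1" using real_arch_pow[of 2 a] by auto
  obtain m2 :: nat where m2: "1 / c < 2 ^ m2" using real_arch_pow[of 2 "1 / c"] by auto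
  have "(2::real) ^ m1 \<le> 2 ^ max m1 m2" "(2::real) ^ m2 \<le> 2 ^ max m1 m2"
    by (rule power_increasing; simp)+
  with m1 m2 have "a \<le> 2 ^ max m1 m2" "1 / c \<le> 2 ^ max m1 m2"
    by linarith+
  then have "a \<le> 2 powr real (max m1 m2)" "2 powr (- real (max m1 m2)) \<le> c"
    using c by (simp_all add: powr_realpow powr_minus divide_simps mult.commute)
  moreover have "c \<le> norm x" if "x \<in> K" for x
    using c that by (force simp: not_le[symmetric])
  ultimately have "K \<subseteq> annulus (max m1 m2)"
    using a by (force simp: annulus_def)
  then show ?thesis by (rule that)
qed

lemma annulus_singleton:
  assumes "x \<noteq> 0"
  obtains m where "x \<in> annulus m"
  using closed_subset_annulus[of "{x}"] assms by (metis compact_sing insert_subset singletonD)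

lemma dyadic_shell_cover:
  assumes "x \<noteq> 0"
  obtains k where "x \<in> dyadic_shell k"
proof
  have "norm x = 2 powr log 2 (norm x)" using assms by simp
  moreover have "real_of_int \<lceil>log 2 (norm x)\<rceil> - 1 < log 2 (norm x)" "log 2 (norm x) \<le> \<lceil>log 2 (norm x)\<rceil>"
    by linarith+
  ultimately show "x \<in> dyadic_shell \<lceil>log 2 (norm x)\<rceil>"
    unfolding mem_dyadic_shell by (metis of_int_1 of_int_diff powr_less_cancel_iff powr_le_cancel_iff numeral_One one_less_numeral_iff semiring_norm(76))
qed

text \<open>The summand 1 accommodates the inner radius 2^(k - 1) when k \<le> 0.\<close>

lemma dyadic_shell_subset_annulus: "dyadic_shell k \<subseteq> annulus (nat \<bar>k\<bar> + 1)"
proof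
  fix x :: "real ^ 'a" assume x: "x \<in> dyadic_shell k"
  have "2 powr (- real (nat \<bar>k\<bar> + 1)) \<le> (2::real) powr (real_of_int k - 1)" "(2::real) powr k \<le> 2 powr real (nat \<bar>k\<bar> + 1)"
    by simp_all
  moreover have "2 powr (real_of_int k - 1) < norm x" "norm x \<le> 2 powr k"
    using x by (simp_all add: mem_dyadic_shell)
  ultimately show "x \<in> annulus (nat \<bar>k\<bar> + 1)"
    unfolding annulus_def by (intro CollectI conjI; linarith)
qed

lemma annulus_subset_shells: "annulus m \<subseteq> (\<Union>k\<in>{- int m..int m}. dyadic_shell k)"
proof
  fix x :: "real ^ 'a" assume x: "x \<in> annulus m"
  then have "x \<noteq> 0" using zero_notin_annulus by metis
  then obtain k where k: "x \<in> dyadic_shell k" using dyadic_shell_cover by blast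
  have "2 powr (real_of_int k - 1) < norm x" "norm x \<le> 2 powr k"
    "2 powr (- real m) \<le> norm x" "norm x \<le> 2 powr real m"
    using x k by (simp_all add: mem_dyadic_shell annulus_def)
  then have "2 powr (real_of_int k - 1) < (2 :: real) powr real m" "2 powr (- real m) \<le> (2 :: real) powr k"
    by linarith+
  then have "real_of_int k - 1 < real m" "- real m \<le> real_of_int k"
    by simp_all
  then have "k \<in> {- int m..int m}" by auto
  with k show "x \<in> (\<Union>k\<in>{- int m..int m}. dyadic_shell k)" by blast
qed

lemma sets_annulus [measurable]: "(annulus m :: (real ^ 'n) set) \<in> sets lebesgue"
  using compact_annulus[of m, where 'a = 'n] by (simp add: borel_compact)

section \<open>Exhaustion by annuli and decomposition into shells\<close>

lemma AE_lebesgue_neq_0: "AE x :: real ^ 'n in lebesgue. x \<noteq> 0"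
  by (intro AE_completion AE_lborel_singleton)

lemma SUP_indicator_annulus:
  fixes g :: "real ^ 'n \<Rightarrow> ennreal"
  assumes "x \<noteq> 0"
  shows "(SUP m. g x * indicator (annulus m) x) = g x"
proof (rule antisym)
  obtain m where "x \<in> annulus m" using annulus_singleton[OF assms] by blast
  then show "g x \<le> (SUP m. g x * indicator (annulus m) x)"
    by (intro SUP_upper2[of m]) auto
qed (auto intro!: SUP_least simp: indicator_def)

lemma measurable_from_annuli:
  fixes g :: "real ^ 'n \<Rightarrow> ennreal"
  assumes [measurable]: "\<And>m. (\<lambda>x. g x * indicator (annulus m) x) \<in> borel_measurable lebesgue"
  shows "g \<in> borel_measurable lebesgue"
proof -
  have "(\<lambda>x. SUP m. g x * indicator (annulus m) x) \<in> borel_measurable lebesgue"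
    by (intro borel_measurable_SUP assms) auto
  then have "(\<lambda>x. if x = 0 then g 0 else SUP m. g x * indicator (annulus m) x) \<in> borel_measurable lebesgue"
    by (intro measurable_If) auto
  also have "(\<lambda>x. if x = 0 then g 0 else SUP m. g x * indicator (annulus m) x) = g"
    by (auto simp: SUP_indicator_annulus)
  finally show ?thesis .
qed

lemma comm_integral_SUP:
  assumes [measurable]: "b \<in> borel_measurable lebesgue" "g \<in> borel_measurable lebesgue"
  shows "comm_integral b g x = (SUP m. comm_integral b (\<lambda>y. g y * indicator (annulus m) y) x)"
proof -
  have "comm_integral b g x = (\<integral>\<^sup>+y. (SUP m. ennreal \<bar>b x - b y\<bar> * (g y * indicator (annulus m) y)) \<partial>lebesgue)"
    unfolding comm_integral_def
  proof (rule nn_integral_cong_AE)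
    show "AE y in lebesgue. ennreal \<bar>b x - b y\<bar> * g y
        = (SUP m. ennreal \<bar>b x - b y\<bar> * (g y * indicator (annulus m) y))"
      using AE_lebesgue_neq_0
    proof eventually_elim
      case (elim y)
      show ?case by (subst SUP_mult_left_ennreal[symmetric]) (simp only: SUP_indicator_annulus[OF elim])
    qed
  qed
  also have "\<dots> = (SUP m. comm_integral b (\<lambda>y. g y * indicator (annulus m) y) x)"
    unfolding comm_integral_def
  proof (rule nn_integral_monotone_convergence_SUP)
    show "incseq (\<lambda>m y. ennreal \<bar>b x - b y\<bar> * (g y * indicator (annulus m) y))"
    proof (intro monoI le_funI mult_left_mono)
      fix m n :: nat and y :: "real ^ 'a" assume "m \<le> n"
      then show "indicator (annulus m) y \<le> (indicator (annulus n) y :: ennreal)"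
        using monoD[OF incseq_annulus, of m n] by (auto simp: indicator_def)
    qed auto
  qed measurable
  finally show ?thesis .
qed

text \<open>The suprema over radii and over m commute. This exhibits the maximal function as a
  countable supremum of maximal functions of truncations, from which its measurability will
  follow.\<close>

lemma max_comm_SUP:
  assumes [measurable]: "b \<in> borel_measurable lebesgue" "g \<in> borel_measurable lebesgue"
  shows "max_comm l b g x = (SUP m. max_comm l b (\<lambda>y. g y * indicator (annulus m) y) x)"
proof -
  have [measurable]: "cball x r \<in> sets lebesgue" for r by simp
  have "comm_integral b (\<lambda>y. g y * indicator (cball x r) y) x
      = (SUP m. comm_integral b (\<lambda>y. g y * indicator (annulus m) y * indicator (cball x r) y) x)" for r
    by (subst comm_integral_SUP) (simp_all add: mult_ac)
  then show ?thesis
    unfolding max_comm_def by (simp add: SUP_mult_left_ennreal) (rule SUP_commute)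
qed

text \<open>Countable sublinearity. At a fixed radius the sum and the integral are exchanged, the
  origin being a null set outside all shells; each term is then enlarged to its own
  supremum.\<close>

lemma max_comm_le_shells:
  assumes [measurable]: "b \<in> borel_measurable lebesgue" "g \<in> borel_measurable lebesgue"
  shows "max_comm l b g x \<le> (\<integral>\<^sup>+j. max_comm l b (\<lambda>y. g y * indicator (dyadic_shell j) y) x \<partial>count_space UNIV)"
  unfolding max_comm_def
proof (rule SUP_least)
  fix r :: real assume r: "r \<in> {0<..}"
  let ?c = "ennreal (measure lebesgue (cball x r) powr (- (1 - 1 / l)))"
  let ?g = "\<lambda>j y. g y * indicator (dyadic_shell j) y"
  have [measurable]: "cball x r \<in> sets lebesgue" by simp
  have "comm_integral b (\<lambda>y. g y * indicator (cball x r) y) x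
      \<le> (\<integral>\<^sup>+y. \<integral>\<^sup>+j. ennreal \<bar>b x - b y\<bar> * (?g j y * indicator (cball x r) y) \<partial>count_space UNIV \<partial>lebesgue)"
    unfolding comm_integral_def
  proof (rule nn_integral_mono_AE)
    show "AE y in lebesgue. ennreal \<bar>b x - b y\<bar> * (g y * indicator (cball x r) y)
        \<le> (\<integral>\<^sup>+j. ennreal \<bar>b x - b y\<bar> * (?g j y * indicator (cball x r) y) \<partial>count_space UNIV)"
      using AE_lebesgue_neq_0
    proof eventually_elim
      case (elim y)
      obtain j where j: "y \<in> dyadic_shell j" using dyadic_shell_cover[OF elim] by blast
      have "ennreal \<bar>b x - b y\<bar> * (g y * indicator (cball x r) y)
          = ennreal \<bar>b x - b y\<bar> * (?g j y * indicator (cball x r) y)" using j by simp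
      also have "\<dots> \<le> (\<integral>\<^sup>+j. ennreal \<bar>b x - b y\<bar> * (?g j y * indicator (cball x r) y) \<partial>count_space UNIV)"
        by (rule nn_integral_ge_point) simp
      finally show ?case .
    qed
  qed
  also have "\<dots> = (\<integral>\<^sup>+j. comm_integral b (\<lambda>y. ?g j y * indicator (cball x r) y) x \<partial>count_space UNIV)"
    unfolding comm_integral_def by (rule nn_integral_count_space_nn_integral) auto
  finally have "?c * comm_integral b (\<lambda>y. g y * indicator (cball x r) y) x
      \<le> ?c * (\<integral>\<^sup>+j. comm_integral b (\<lambda>y. ?g j y * indicator (cball x r) y) x \<partial>count_space UNIV)"
    by (rule mult_left_mono) simp
  also have "\<dots> = (\<integral>\<^sup>+j. ?c * comm_integral b (\<lambda>y. ?g j y * indicator (cball x r) y) x \<partial>count_space UNIV)"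
    by (simp add: nn_integral_cmult)
  also have "\<dots> \<le> (\<integral>\<^sup>+j. (SUP r\<in>{0<..}. ennreal (measure lebesgue (cball x r) powr (- (1 - 1 / l))) *
      comm_integral b (\<lambda>y. ?g j y * indicator (cball x r) y) x) \<partial>count_space UNIV)"
    using r by (intro nn_integral_mono SUP_upper2[of r]) auto
  finally show "?c * comm_integral b (\<lambda>y. g y * indicator (cball x r) y) x
    \<le> (\<integral>\<^sup>+j. (SUP r\<in>{0<..}. ennreal (measure lebesgue (cball x r) powr (- (1 - 1 / l))) *
      comm_integral b (\<lambda>y. ?g j y * indicator (cball x r) y) x) \<partial>count_space UNIV)" .
qed

text \<open>Absorbs the linear growth of the oscillation into an arbitrarily small exponential rate.
  With a = \<epsilon> ln 2, the bound exp(a x) \<ge> 1 + a x multiplied by 1 + 1/a already contains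
  1 + x.\<close>

lemma one_plus_le_powr:
  fixes \<epsilon> x :: real
  assumes "0 < \<epsilon>" "0 \<le> x"
  shows "x + 1 \<le> (1 + 1 / (\<epsilon> * ln 2)) * 2 powr (\<epsilon> * x)"
proof -
  have pos: "0 < \<epsilon> * ln 2" using assms by simp
  have "1 + \<epsilon> * x * ln 2 \<le> 2 powr (\<epsilon> * x)"
    using exp_ge_add_one_self[of "\<epsilon> * x * ln 2"] by (simp add: powr_def mult.commute)
  then have "(1 + 1 / (\<epsilon> * ln 2)) * (1 + \<epsilon> * x * ln 2) \<le> (1 + 1 / (\<epsilon> * ln 2)) * 2 powr (\<epsilon> * x)"
    using pos by (intro mult_left_mono) auto
  moreover have "(1 + 1 / (\<epsilon> * ln 2)) * (1 + \<epsilon> * x * ln 2) = 1 + x + (1 / (\<epsilon> * ln 2) + x * (\<epsilon> * ln 2))"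
    using assms by (simp add: field_simps)
  moreover have "0 \<le> 1 / (\<epsilon> * ln 2) + x * (\<epsilon> * ln 2)"
    using pos assms by (intro add_nonneg_nonneg mult_nonneg_nonneg) auto
  ultimately show ?thesis by linarith
qed

section \<open>Shell norms of the maximal function as a convolution\<close>

context bounded_max_comm
begin

lemma measurable_max_comm_of_annuli:
  assumes "\<And>m. mixed_nn_norm q1 (\<lambda>x. g x * indicator (annulus m) x) < top"
    and [measurable]: "g \<in> borel_measurable lebesgue"
  shows "M g \<in> borel_measurable lebesgue"
proof -
  have "M g = (\<lambda>x. SUP m. M (\<lambda>y. g y * indicator (annulus m) y) x)"
    by (intro ext max_comm_SUP) measurable
  moreover have "M (\<lambda>y. g y * indicator (annulus m) y) \<in> borel_measurable lebesgue" for m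
    by (rule measurable_max_comm) (use assms in auto)
  ultimately show ?thesis by simp
qed

lemma norm_max_comm_convolution:
  assumes "0 \<le> lam" "lam - s2 < \<alpha>" "\<alpha> < N - s1"
  obtains C \<epsilon> where "C < top" "0 < \<epsilon>"
    "\<And>g k. g \<in> borel_measurable lebesgue \<Longrightarrow>
      (\<And>j. mixed_nn_norm q1 (\<lambda>x. g x * indicator (dyadic_shell j) x) < top) \<Longrightarrow>
      pw (k * \<alpha>) * mixed_nn_norm q2 (\<lambda>x. M g x * indicator (dyadic_shell k) x)
      \<le> C * (\<integral>\<^sup>+d. pw (real_of_int d * lam - 2 * \<epsilon> * \<bar>real_of_int d\<bar>) *
          (pw (real_of_int (k - d) * \<alpha>) * mixed_nn_norm q1 (\<lambda>x. g x * indicator (dyadic_shell (k - d)) x)) \<partial>count_space UNIV)"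
proof -
  obtain K where K: "K < top"
    "\<And>g j k. g \<in> borel_measurable lebesgue \<Longrightarrow> mixed_nn_norm q1 g < top \<Longrightarrow>
      (\<And>y. y \<notin> dyadic_shell j \<Longrightarrow> g y = 0) \<Longrightarrow>
      mixed_nn_norm q2 (\<lambda>x. M g x * indicator (dyadic_shell k) x)
        \<le> ennreal (real_of_int \<bar>j - k\<bar> + 1) * K * pw (j * (N - s1) + k * s2 - real_of_int (max j k) * \<tau>) * mixed_nn_norm q1 g"
    using norm_max_comm_shell by blast
  \<comment> \<open>A third of the available decay absorbs the factor |j - k| + 1; the other two
    thirds form the rate 2 \<epsilon> that \<open>herz_seq_norm_convolution\<close> expects.\<close>
  define \<epsilon> where "\<epsilon> = min (N - s1 - \<alpha>) (s2 + \<alpha> - lam) / 3"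
  have \<epsilon>: "0 < \<epsilon>" "3 * \<epsilon> \<le> N - s1 - \<alpha>" "3 * \<epsilon> \<le> s2 + \<alpha> - lam"
    using assms by (auto simp: \<epsilon>_def)
  define c where "c = ennreal (1 + 1 / (\<epsilon> * ln 2))"
  \<comment> \<open>Here d = k - j. For d \<ge> 0, pieces nearer the origin, the weighted exponent
    is -d (N - s1 - \<alpha>), and lam \<ge> 0 only gives room on the right. For d < 0 it is -|d|
    (s2 + \<alpha>), while the right side asks for an additional decay lam |d|. These are the upper
    and the lower restriction on \<alpha>.\<close>
  have expo: "\<epsilon> * \<bar>real_of_int d\<bar> + (real_of_int (k - d) * (N - s1) + k * s2 - real_of_int (max (k - d) k) * \<tau> + d * \<alpha>)
      \<le> d * lam - 2 * \<epsilon> * \<bar>real_of_int d\<bar>" for k d :: int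
  proof (cases "0 \<le> d")
    case True
    then have "real_of_int d * (3 * \<epsilon>) \<le> real_of_int d * (N - s1 - \<alpha>)" "0 \<le> real_of_int d * lam"
      using \<epsilon> assms by (auto intro: mult_left_mono)
    moreover have "max (k - d) k = k" using True by simp
    ultimately show ?thesis using True by (simp add: \<tau>_def algebra_simps)
  next
    case False
    then have "real_of_int (- d) * (3 * \<epsilon>) \<le> real_of_int (- d) * (s2 + \<alpha> - lam)"
      using \<epsilon> by (intro mult_left_mono) auto
    moreover have "max (k - d) k = k - d" using False by simp
    ultimately show ?thesis using False by (simp add: \<tau>_def algebra_simps)
  qed
  have "pw (k * \<alpha>) * mixed_nn_norm q2 (\<lambda>x. M g x * indicator (dyadic_shell k) x)
      \<le> (c * K) * (\<integral>\<^sup>+d. pw (real_of_int d * lam - 2 * \<epsilon> * \<bar>real_of_int d\<bar>) *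
          (pw (real_of_int (k - d) * \<alpha>) * mixed_nn_norm q1 (\<lambda>x. g x * indicator (dyadic_shell (k - d)) x)) \<partial>count_space UNIV)"
    if [measurable]: "g \<in> borel_measurable lebesgue"
      and fin: "\<And>j. mixed_nn_norm q1 (\<lambda>x. g x * indicator (dyadic_shell j) x) < top" for g k
  proof -
    let ?g = "\<lambda>j y. g y * indicator (dyadic_shell j) y :: ennreal"
    let ?n = "\<lambda>j. mixed_nn_norm q1 (?g j)"
    let ?e = "\<lambda>j. real_of_int j * (N - s1) + k * s2 - real_of_int (max j k) * \<tau>"
    have [measurable]: "M (?g j) \<in> borel_measurable lebesgue" for j
      by (rule measurable_max_comm) (use fin in auto)
    have "mixed_nn_norm q2 (\<lambda>x. M g x * indicator (dyadic_shell k) x)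
        \<le> mixed_nn_norm q2 (\<lambda>x. \<integral>\<^sup>+j. M (?g j) x * indicator (dyadic_shell k) x \<partial>count_space UNIV)"
    proof (intro mixed_nn_norm_mono q_pos)
      fix x
      show "M g x * indicator (dyadic_shell k) x \<le> (\<integral>\<^sup>+j. M (?g j) x * indicator (dyadic_shell k) x \<partial>count_space UNIV)"
        using max_comm_le_shells[OF b that(1), of l x] by (simp add: nn_integral_multc mult_right_mono)
    qed
    also have "\<dots> \<le> (\<integral>\<^sup>+j. mixed_nn_norm q2 (\<lambda>x. M (?g j) x * indicator (dyadic_shell k) x) \<partial>count_space UNIV)"
      by (intro mixed_nn_norm_count_space q2) measurable
    also have "\<dots> \<le> (\<integral>\<^sup>+j. ennreal (real_of_int \<bar>j - k\<bar> + 1) * K * pw (?e j) * ?n j \<partial>count_space UNIV)"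
      by (intro nn_integral_mono K fin) auto
    also have "\<dots> = (\<integral>\<^sup>+d. ennreal (real_of_int \<bar>(k - d) - k\<bar> + 1) * K * pw (?e (k - d)) * ?n (k - d) \<partial>count_space UNIV)"
      by (rule nn_integral_bij_count_space[symmetric, of "\<lambda>d. k - d"])
        (auto intro!: bij_betwI[where g = "\<lambda>d. k - d"])
    finally have "pw (k * \<alpha>) * mixed_nn_norm q2 (\<lambda>x. M g x * indicator (dyadic_shell k) x)
      \<le> pw (k * \<alpha>) * (\<integral>\<^sup>+d. ennreal (real_of_int \<bar>(k - d) - k\<bar> + 1) * K * pw (?e (k - d)) * ?n (k - d) \<partial>count_space UNIV)"
      by (rule mult_left_mono) simp
    also have "\<dots> = (\<integral>\<^sup>+d. pw (k * \<alpha>) * (ennreal (real_of_int \<bar>(k - d) - k\<bar> + 1) * K * pw (?e (k - d)) * ?n (k - d)) \<partial>count_space UNIV)"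
      by (simp add: nn_integral_cmult)
    also have "\<dots> \<le> (\<integral>\<^sup>+d. (c * K) * (pw (real_of_int d * lam - 2 * \<epsilon> * \<bar>real_of_int d\<bar>) *
        (pw (real_of_int (k - d) * \<alpha>) * ?n (k - d))) \<partial>count_space UNIV)"
    proof (intro nn_integral_mono)
      fix d
      have "ennreal (real_of_int \<bar>(k - d) - k\<bar> + 1) \<le> c * pw (\<epsilon> * \<bar>real_of_int d\<bar>)"
        using one_plus_le_powr[OF \<epsilon>(1), of "\<bar>real_of_int d\<bar>"] \<epsilon>(1)
        by (simp add: c_def ennreal_mult[symmetric] ennreal_leI del: ennreal_plus)
      then have "ennreal (real_of_int \<bar>(k - d) - k\<bar> + 1) * (pw (k * \<alpha>) * K * pw (?e (k - d)) * ?n (k - d))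
        \<le> c * pw (\<epsilon> * \<bar>real_of_int d\<bar>) * (pw (k * \<alpha>) * K * pw (?e (k - d)) * ?n (k - d))"
        by (rule mult_right_mono) simp
      also have "\<dots> = c * K * (pw (\<epsilon> * \<bar>real_of_int d\<bar>) * pw (?e (k - d)) * pw (k * \<alpha>)) * ?n (k - d)"
        by (simp only: mult_ac)
      also have "pw (\<epsilon> * \<bar>real_of_int d\<bar>) * pw (?e (k - d)) * pw (k * \<alpha>)
          = pw (\<epsilon> * \<bar>real_of_int d\<bar> + (?e (k - d) + d * \<alpha>)) * pw (real_of_int (k - d) * \<alpha>)"
        unfolding pw_mult by (simp add: algebra_simps)
      also have "c * K * (pw (\<epsilon> * \<bar>real_of_int d\<bar> + (?e (k - d) + d * \<alpha>)) * pw (real_of_int (k - d) * \<alpha>)) * ?n (k - d)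
          \<le> c * K * (pw (d * lam - 2 * \<epsilon> * \<bar>real_of_int d\<bar>) * pw (real_of_int (k - d) * \<alpha>)) * ?n (k - d)"
        by (intro mult_right_mono mult_left_mono ennreal_leI powr_mono expo) auto
      finally show "pw (k * \<alpha>) * (ennreal (real_of_int \<bar>(k - d) - k\<bar> + 1) * K * pw (?e (k - d)) * ?n (k - d))
        \<le> (c * K) * (pw (real_of_int d * lam - 2 * \<epsilon> * \<bar>real_of_int d\<bar>) * (pw (real_of_int (k - d) * \<alpha>) * ?n (k - d)))"
        by (simp only: mult_ac)
    qed
    also have "\<dots> = (c * K) * (\<integral>\<^sup>+d. pw (real_of_int d * lam - 2 * \<epsilon> * \<bar>real_of_int d\<bar>) *
        (pw (real_of_int (k - d) * \<alpha>) * ?n (k - d)) \<partial>count_space UNIV)"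
      by (simp add: nn_integral_cmult)
    finally show ?thesis .
  qed
  moreover have "c * K < top" using K(1) by (simp add: c_def ennreal_mult_less_top)
  ultimately show ?thesis using \<epsilon>(1) that by blast
qed

end

section \<open>From the hypotheses to the theorem\<close>

lemma bmo_measurable:
  assumes "b \<in> bmo"
  shows "b \<in> borel_measurable lebesgue"
proof -
  have "(\<lambda>x. indicator (cball 0 (real m)) x *\<^sub>R b x) \<in> borel_measurable lebesgue" for m :: nat
  proof -
    have "set_integrable lebesgue (cball 0 (real m)) b" using assms by (auto simp: bmo_def)
    then show ?thesis unfolding set_integrable_def by (rule borel_measurable_integrable)
  qed
  moreover have "(\<lambda>m. indicator (cball 0 (real m)) x *\<^sub>R b x) \<longlonglongrightarrow> b x" for x
  proof (rule tendsto_eventually)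
    obtain m0 :: nat where "norm x \<le> real m0" using real_arch_simple by blast
    then show "\<forall>\<^sub>F m in sequentially. indicator (cball 0 (real m)) x *\<^sub>R b x = b x"
      by (intro eventually_mono[OF eventually_ge_at_top[of m0]]) auto
  qed
  ultimately show ?thesis by (rule borel_measurable_LIMSEQ_metric)
qed

text \<open>The operator and the norms only see |f|, so a nonnegative g is tested through its
  extended real version \<open>enn2ereal (g x)\<close>.\<close>

lemma bounded_max_comm_of_bounded_operator:
  fixes q1 q2 :: "real ^ 'n::{finite,linorder}"
  assumes "1 < l" "\<And>i. 1 \<le> q1 $ i" "\<And>i. 1 \<le> q2 $ i" "b \<in> bmo"
    and "real CARD('n) / l = (\<Sum>i\<in>UNIV. 1 / q1 $ i) - (\<Sum>i\<in>UNIV. 1 / q2 $ i)"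
    and "bounded_operator (frac_max_comm l b)
           (mixed_lebesgue q1) (mixed_norm q1) (mixed_lebesgue q2) (mixed_norm q2)"
  obtains D where "bounded_max_comm l D b q1 q2"
proof -
  have pos: "0 < q1 $ i" "0 < q2 $ i" for i using assms(2)[of i] assms(3)[of i] by simp_all
  obtain D where D: "\<And>f. f \<in> mixed_lebesgue q1 \<Longrightarrow>
      frac_max_comm l b f \<in> mixed_lebesgue q2 \<and> mixed_norm q2 (frac_max_comm l b f) \<le> ennreal D * mixed_norm q1 f"
    using assms(6) unfolding bounded_operator_def by blast
  have "max_comm l b g \<in> borel_measurable lebesgue \<and> mixed_nn_norm q2 (max_comm l b g) \<le> ennreal D * mixed_nn_norm q1 g"
    if g [measurable]: "g \<in> borel_measurable lebesgue" and fin: "mixed_nn_norm q1 g < top" for g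
  proof -
    define f where "f = (\<lambda>x. enn2ereal (g x))"
    have norm: "mixed_norm q1 f = mixed_nn_norm q1 g"
      using pos by (simp add: mixed_norm_eq f_def)
    have "f \<in> borel_measurable lebesgue" unfolding f_def by measurable
    then have "f \<in> mixed_lebesgue q1"
      using fin by (simp add: mixed_lebesgue_def norm)
    moreover have Mf: "frac_max_comm l b f = (\<lambda>x. enn2ereal (max_comm l b g x))"
      by (simp add: frac_max_comm_eq[abs_def] f_def)
    ultimately have "(\<lambda>x. enn2ereal (max_comm l b g x)) \<in> borel_measurable lebesgue"
      and "mixed_norm q2 (\<lambda>x. enn2ereal (max_comm l b g x)) \<le> ennreal D * mixed_nn_norm q1 g"
      using D[of f] norm by (auto simp: mixed_lebesgue_def)
    then show ?thesis
      using measurable_compose[of _ lebesgue borel e2ennreal borel] pos by (force simp: mixed_norm_eq)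
  qed
  then have "bounded_max_comm l D b q1 q2"
    using assms bmo_measurable by unfold_locales auto
  then show ?thesis by (rule that)
qed

theorem theorem4p2:
  fixes l lam \<alpha> :: real
    and p1 p2 :: ennreal
    and q1 q2 :: "real ^ 'n::{finite,linorder}"
    and b :: "real ^ 'n::{finite,linorder} \<Rightarrow> real"
  assumes "1 < l"
    and "0 \<le> lam"
    and "0 < p1" and "p1 \<le> p2"
    and "\<And>i. 1 < q1 $ i" and "\<And>i. q1 $ i < l"
    and "\<And>i. 1 \<le> q2 $ i"
    and "1 / l = 1 / real CARD('n) * (\<Sum>i\<in>UNIV. 1 / q1 $ i)
               - 1 / real CARD('n) * (\<Sum>i\<in>UNIV. 1 / q2 $ i)"
    and "lam - (\<Sum>i\<in>UNIV. 1 / q2 $ i) < \<alpha>"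
    and "\<alpha> < real CARD('n) - (\<Sum>i\<in>UNIV. 1 / q1 $ i)"
    and "b \<in> bmo"
    and "bounded_operator (frac_max_comm l b)
           (mixed_lebesgue q1) (mixed_norm q1) (mixed_lebesgue q2) (mixed_norm q2)"
  shows "bounded_operator (frac_max_comm l b)
           (herz_morrey \<alpha> lam p1 q1) (herz_morrey_norm \<alpha> lam p1 q1)
           (herz_morrey \<alpha> lam p2 q2) (herz_morrey_norm \<alpha> lam p2 q2)"
proof -
  have q1: "1 \<le> q1 $ i" "0 < q1 $ i" and q2: "1 \<le> q2 $ i" "0 < q2 $ i" for i
    using assms(5)[of i] assms(7)[of i] by simp_all
  have p1: "0 < p1" and p2: "0 < p2" using assms(3,4) by simp_all
  have "real CARD('n) / l = real CARD('n) * (1 / l)" by simp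
  also have "\<dots> = (\<Sum>i\<in>UNIV. 1 / q1 $ i) - (\<Sum>i\<in>UNIV. 1 / q2 $ i)"
    unfolding assms(8) by (simp add: right_diff_distrib)
  finally have exps: "real CARD('n) / l = (\<Sum>i\<in>UNIV. 1 / q1 $ i) - (\<Sum>i\<in>UNIV. 1 / q2 $ i)" .
  obtain D where D: "bounded_max_comm l D b q1 q2"
    using bounded_max_comm_of_bounded_operator[OF assms(1) q1(1) q2(1) assms(11) exps assms(12)] .
  interpret bounded_max_comm l D b q1 q2 by (rule D)
  have rng: "lam - s2 < \<alpha>" "\<alpha> < N - s1"
    using assms(9,10) by (simp_all add: s1_def s2_def N_def)
  obtain C \<epsilon> where C: "C < top" "0 < \<epsilon>"
    "\<And>g k. g \<in> borel_measurable lebesgue \<Longrightarrow>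
      (\<And>j. mixed_nn_norm q1 (\<lambda>x. g x * indicator (dyadic_shell j) x) < top) \<Longrightarrow>
      pw (k * \<alpha>) * mixed_nn_norm q2 (\<lambda>x. M g x * indicator (dyadic_shell k) x)
      \<le> C * (\<integral>\<^sup>+d. pw (real_of_int d * lam - 2 * \<epsilon> * \<bar>real_of_int d\<bar>) *
          (pw (real_of_int (k - d) * \<alpha>) * mixed_nn_norm q1 (\<lambda>x. g x * indicator (dyadic_shell (k - d)) x)) \<partial>count_space UNIV)"
    using norm_max_comm_convolution[OF assms(2) rng] by blast
  obtain C' where C': "C' < top"
    "\<And>U V. (\<And>k. V k \<le> C * (\<integral>\<^sup>+d. pw (real_of_int d * lam - 2 * \<epsilon> * \<bar>real_of_int d\<bar>) * U (k - d) \<partial>count_space UNIV))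
      \<Longrightarrow> herz_seq_norm lam p1 V \<le> C' * herz_seq_norm lam p1 U"
    using herz_seq_norm_convolution[OF C(2) assms(2,3) C(1)] by blast
  show ?thesis
    unfolding bounded_operator_def
  proof (intro exI[of _ "enn2real C'"] ballI)
    fix f assume f: "f \<in> herz_morrey \<alpha> lam p1 q1"
    define g where "g = (\<lambda>x. e2ennreal \<bar>f x\<bar>)"
    have Mf: "frac_max_comm l b f = (\<lambda>x. enn2ereal (M g x))"
      by (simp add: frac_max_comm_eq[abs_def] g_def)
    have ind: "e2ennreal \<bar>f x * indicator A x\<bar> = g x * indicator A x" for x and A :: "(real ^ 'n::{finite,linorder}) set"
      by (simp add: g_def indicator_def e2ennreal_neg)
    have loc: "(\<lambda>x. g x * indicator (annulus m) x) \<in> borel_measurable lebesgue"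
      "mixed_nn_norm q1 (\<lambda>x. g x * indicator (annulus m) x) < top" for m
    proof -
      have "(\<lambda>x. f x * indicator (annulus m) x) \<in> mixed_lebesgue q1"
        using f compact_annulus zero_notin_annulus[of m, where 'a = 'n]
        unfolding herz_morrey_def mixed_lebesgue_loc_def by auto
      then have meas: "(\<lambda>x. f x * indicator (annulus m) x) \<in> borel_measurable lebesgue"
        and fin: "mixed_norm q1 (\<lambda>x. f x * indicator (annulus m) x) < top"
        by (auto simp: mixed_lebesgue_def)
      from meas have "(\<lambda>x. e2ennreal \<bar>f x * indicator (annulus m) x\<bar>) \<in> borel_measurable lebesgue"
        by measurable
      then show "(\<lambda>x. g x * indicator (annulus m) x) \<in> borel_measurable lebesgue"
        unfolding ind .
      show "mixed_nn_norm q1 (\<lambda>x. g x * indicator (annulus m) x) < top"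
        using fin q_pos by (simp add: mixed_norm_eq ind)
    qed
    \<comment> \<open>f is only locally in L^q1 away from the origin; the measurability of |f|, and
      then that of M f, is assembled from the annuli.\<close>
    note g [measurable] = measurable_from_annuli[OF loc(1)]
    note [measurable] = measurable_max_comm_of_annuli[OF loc(2) g]
    have fin: "mixed_nn_norm q1 (\<lambda>x. g x * indicator (dyadic_shell j) x) < top" for j
    proof -
      have "mixed_nn_norm q1 (\<lambda>x. g x * indicator (dyadic_shell j) x)
          \<le> mixed_nn_norm q1 (\<lambda>x. g x * indicator (annulus (nat \<bar>j\<bar> + 1)) x)"
        using dyadic_shell_subset_annulus[of j] q_pos by (intro mixed_nn_norm_mono) (auto simp: indicator_def)
      then show ?thesis using loc(2) by (rule le_less_trans)
    qed
    define U where "U = (\<lambda>k. pw (real_of_int k * \<alpha>) * mixed_nn_norm q1 (\<lambda>x. g x * indicator (dyadic_shell k) x))"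
    define V where "V = (\<lambda>k. pw (real_of_int k * \<alpha>) * mixed_nn_norm q2 (\<lambda>x. M g x * indicator (dyadic_shell k) x))"
    have nf: "herz_morrey_norm \<alpha> lam p1 q1 f = herz_seq_norm lam p1 U"
      using q_pos by (simp add: herz_morrey_norm_eq[OF p1] shell_norm_eq U_def g_def)
    have nMf: "herz_morrey_norm \<alpha> lam p2 q2 (frac_max_comm l b f) = herz_seq_norm lam p2 V"
      using q_pos by (simp add: herz_morrey_norm_eq[OF p2] shell_norm_eq V_def Mf)
    \<comment> \<open>The convolution estimate keeps p1 on both sides; p2 enters afterwards, through
      \<open>herz_seq_norm_antimono\<close> applied to the image.\<close>
    have "herz_seq_norm lam p1 V \<le> C' * herz_seq_norm lam p1 U"
      unfolding U_def V_def by (intro C'(2) C(3) g fin)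
    then have bound: "herz_seq_norm lam p2 V \<le> ennreal (enn2real C') * herz_seq_norm lam p1 U"
      using C'(1) order_trans[OF herz_seq_norm_antimono[OF assms(3,4)]] by simp
    have "herz_seq_norm lam p1 U < top"
      using f by (simp add: herz_morrey_def nf)
    then have finV: "herz_seq_norm lam p2 V < top"
      using bound C'(1) by (auto simp: ennreal_mult_less_top intro: le_less_trans)
    have finM: "mixed_nn_norm q2 (\<lambda>x. M g x * indicator (dyadic_shell k) x) < top" for k
    proof -
      have "V k < top"
        using le_herz_seq_norm[OF p2 order_refl, of V k lam] finV
        by (auto simp: ennreal_mult_less_top intro: le_less_trans)
      then show ?thesis by (auto simp: V_def ennreal_mult_less_top)
    qed
    \<comment> \<open>A compact set avoiding the origin is covered by finitely many shells, and on
      each of them the norm of M f is finite because its sequence norm is.\<close>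
    have "(\<lambda>x. frac_max_comm l b f x * indicator K x) \<in> mixed_lebesgue q2"
      if K: "compact K" "K \<subseteq> - {0}" for K
    proof -
      obtain m where m: "K \<subseteq> annulus m" using closed_subset_annulus[of K] K by blast
      have [measurable]: "K \<in> sets lebesgue" using K(1) by (simp add: borel_compact)
      have Kind: "e2ennreal \<bar>enn2ereal (M g x) * indicator K x\<bar> = M g x * indicator K x" for x
        by (simp add: indicator_def e2ennreal_neg)
      have "mixed_nn_norm q2 (\<lambda>x. M g x * indicator K x)
          \<le> mixed_nn_norm q2 (\<lambda>x. \<Sum>k\<in>{- int m..int m}. M g x * indicator (dyadic_shell k) x)"
      proof (intro mixed_nn_norm_mono q_pos)
        fix x
        show "M g x * indicator K x \<le> (\<Sum>k\<in>{- int m..int m}. M g x * indicator (dyadic_shell k) x)"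
        proof (cases "x \<in> K")
          case True
          then obtain k where k: "k \<in> {- int m..int m}" "x \<in> dyadic_shell k"
            using m annulus_subset_shells[of m] by blast
          have "M g x * indicator K x = M g x * indicator (dyadic_shell k) x" using True k by simp
          also have "\<dots> \<le> (\<Sum>k\<in>{- int m..int m}. M g x * indicator (dyadic_shell k) x)"
            by (rule member_le_sum) (use k in auto)
          finally show ?thesis .
        qed simp
      qed
      also have "\<dots> \<le> (\<Sum>k\<in>{- int m..int m}. mixed_nn_norm q2 (\<lambda>x. M g x * indicator (dyadic_shell k) x))"
        by (intro mixed_nn_norm_sum q2) measurable
      also have "\<dots> < top" using finM by simp
      finally have "mixed_norm q2 (\<lambda>x. frac_max_comm l b f x * indicator K x) < top"
        by (simp only: mixed_norm_eq[OF q_pos(2)] Mf Kind)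
      moreover have "(\<lambda>x. frac_max_comm l b f x * indicator K x) \<in> borel_measurable lebesgue"
        unfolding Mf by measurable
      ultimately show ?thesis by (simp add: mixed_lebesgue_def)
    qed
    then have "frac_max_comm l b f \<in> mixed_lebesgue_loc (- {0}) q2"
      unfolding mixed_lebesgue_loc_def by blast
    then show "frac_max_comm l b f \<in> herz_morrey \<alpha> lam p2 q2 \<and>
        herz_morrey_norm \<alpha> lam p2 q2 (frac_max_comm l b f) \<le> ennreal (enn2real C') * herz_morrey_norm \<alpha> lam p1 q1 f"
      using finV bound by (simp add: herz_morrey_def nMf nf)
  qed
qed

end
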